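(* For all $\Gamma\subseteq\{0,1\}^\infty$, $$\mathrm{dim}(\Gamma)=\inf \mathscr G_{\mathrm{constr}}(\Gamma),$$ where $\mathrm{dim}(\Gamma)$ is the algorithmic dimension of $\Gamma$ and $\mathscr G_{\mathrm{constr}}(\Gamma)=\{s\in[0,\infty) : \text{there exists a learning function } l \text{ which algorithmically } s\text{-learns every } X\in\Gamma\}$.
   Context: For $s\in[0,\infty)$, an $s$-gale is a function $d:\{0,1\}^*\to[0,\infty)$ with $d(w)2^{-s|w|}=d(w0)2^{-s(|w|+1)}+d(w1)2^{-s(|w|+1)}$ for all $w$. A function $f:\{0,1\}^*\to[0,\infty)$ is lower semicomputable if there is a computable $g:\{0,1\}^*\times\mathbb N\to\mathbb Q\cap[0,\infty)$ with $g(w,t)\le g(w,t+1)\le f(w)$ and $\lim_t g(w,t)=f(w)$ for all $w,t$. A gale $d$ succeeds on $X$ if $\limsup_n d(X\upharpoonright n)=\infty$. The algorithmic dimension of $\Gamma$ is $\mathrm{dim}(\Gamma)=\inf\{s\in[0,\infty): \text{some lower semicomputable } s\text{-gale succeeds on every } X\in\Gamma\}$. A learning function is a function $l:\{0,1\}^*\to\{0,1\}$ (yes $=1$, no $=0$). $Y\upharpoonright i$ is the length-$i$ prefix of $Y$; $\lambda$ is the uniform (Lebesgue) measure on $\{0,1\}^\infty$. For nonempty $w$, $\mathrm{AVG}_l(w)=\frac{1}{|w|}\sum_{i=0}^{|w|} l(w\upharpoonright i)$. For $s\ge 0$, $l$ algorithmically $s$-learns $X$ iff: (1) the map $w\mapsto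 \mathrm{AVG}_l(w)$ is lower semicomputable (uniformly in $w$); (2) for all $n\in\mathbb N$, $\lambda(\{Y : \#\{i\in\mathbb N: l(Y\upharpoonright i)=1\}\ge n\})\le 2^{-n}$; (3) $\limsup_{n\to\infty}\mathrm{AVG}_l(X\upharpoonright n)\ge 1-s$. *)

theory Defs
  imports "HOL-Probability.Probability"
begin

text \<open>recfn n f: f is a total recursive function of arity n. Only its values
  on argument lists of length n are relevant.\<close>
inductive recfn :: "nat \<Rightarrow> (nat list \<Rightarrow> nat) \<Rightarrow> bool" where
  zero: "recfn n (\<lambda>_. 0)"
| succ: "recfn 1 (\<lambda>xs. Suc (hd xs))"
| proj: "i < n \<Longrightarrow> recfn n (\<lambda>xs. xs ! i)"
| comp: "recfn k f \<Longrightarrow> length gs = k \<Longrightarrow> (\<forall>g\<in>set gs. recfn n g) \<Longrightarrow>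
           recfn n (\<lambda>xs. f (map (\<lambda>g. g xs) gs))"
| prim: "recfn n g \<Longrightarrow> recfn (n + 2) h \<Longrightarrow>
           recfn (Suc n) (\<lambda>xs. rec_nat (g (tl xs)) (\<lambda>y r. h (y # r # tl xs)) (hd xs))"
| mu: "recfn (Suc n) f \<Longrightarrow> (\<forall>xs. length xs = n \<longrightarrow> (\<exists>y. f (y # xs) = 0)) \<Longrightarrow>
           recfn n (\<lambda>xs. LEAST y. f (y # xs) = 0)"

text \<open>Standard bijective coding of binary strings by natural numbers.\<close>
fun bits_code :: "bool list \<Rightarrow> nat" where
  "bits_code [] = 0"
| "bits_code (b # w) = 2 * bits_code w + (if b then 2 else 1)"

definition computable_rat :: "(bool list \<Rightarrow> nat \<Rightarrow> rat) \<Rightarrow> bool" where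
  "computable_rat g \<longleftrightarrow> (\<exists>p q. recfn 2 p \<and> recfn 2 q \<and>
     (\<forall>w t. g w t = of_nat (p [bits_code w, t]) / of_nat (q [bits_code w, t] + 1)))"

definition lower_semicomputable :: "(bool list \<Rightarrow> real) \<Rightarrow> bool" where
  "lower_semicomputable f \<longleftrightarrow> (\<exists>g. computable_rat g \<and>
     (\<forall>w t. real_of_rat (g w t) \<le> real_of_rat (g w (Suc t)) \<and> real_of_rat (g w t) \<le> f w) \<and>
     (\<forall>w. (\<lambda>t. real_of_rat (g w t)) \<longlonglongrightarrow> f w))"

definition prefix :: "(nat \<Rightarrow> bool) \<Rightarrow> nat \<Rightarrow> bool list" where
  "prefix X n = map X [0..<n]"

definition is_gale :: "real \<Rightarrow> (bool list \<Rightarrow> real) \<Rightarrow> bool" where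
  "is_gale s d \<longleftrightarrow> (\<forall>w. d w \<ge> 0) \<and>
     (\<forall>w. d w * 2 powr (- s * length w) =
          d (w @ [False]) * 2 powr (- s * (length w + 1)) + d (w @ [True]) * 2 powr (- s * (length w + 1)))"

definition succeeds :: "(bool list \<Rightarrow> real) \<Rightarrow> (nat \<Rightarrow> bool) \<Rightarrow> bool" where
  "succeeds d X \<longleftrightarrow> limsup (\<lambda>n. ereal (d (prefix X n))) = \<infinity>"

definition alg_dim :: "(nat \<Rightarrow> bool) set \<Rightarrow> real" where
  "alg_dim \<Gamma> = Inf {s. s \<ge> 0 \<and> (\<exists>d. lower_semicomputable d \<and> is_gale s d \<and> (\<forall>X\<in>\<Gamma>. succeeds d X))}"

definition unif :: "(nat \<Rightarrow> bool) measure" where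
  "unif = PiM UNIV (\<lambda>_. measure_pmf (bernoulli_pmf (1/2)))"

text \<open>A learning function l : {0,1}* -> {0,1}, with True = yes = 1, False = no = 0.\<close>
definition AVG :: "(bool list \<Rightarrow> bool) \<Rightarrow> bool list \<Rightarrow> real" where
  "AVG l w = (\<Sum>i=0..length w. of_bool (l (take i w))) / real (length w)"

definition alg_learns :: "real \<Rightarrow> (bool list \<Rightarrow> bool) \<Rightarrow> (nat \<Rightarrow> bool) \<Rightarrow> bool" where
  "alg_learns s l X \<longleftrightarrow>
     lower_semicomputable (AVG l) \<and>
     (\<forall>n::nat. emeasure unif {Y. infinite {i. l (prefix Y i)} \<or> n \<le> card {i. l (prefix Y i)}}
                 \<le> ennreal (2 powr (- real n))) \<and>
     limsup (\<lambda>n. ereal (AVG l (prefix X n))) \<ge> ereal (1 - s)"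

definition G_constr :: "(nat \<Rightarrow> bool) set \<Rightarrow> real set" where
  "G_constr \<Gamma> = {s. s \<ge> 0 \<and> (\<exists>l. \<forall>X\<in>\<Gamma>. alg_learns s l X)}"

end

(* Both sides are compared with the existence of a c.e. set A of strings with at most C 2^(s n)
   elements of each length n that contains infinitely many prefixes of every X in Gamma.
   From an s-gale d take A = {w. d w > 1}; from a learner take A = {w. AVG w > r} for a rational r
   slightly below 1 - s. Conversely, if 2^t is rational and t > s, the sum over v in A of |v| times
   the t-gale that concentrates its capital on v converges, is a lower semicomputable t-gale, and
   is at least |w| at every w in A. With 2^t rational the martingale 2^((1-t)|w|) d(w) is lower
   semicomputable too, and a learner can say yes whenever it reaches a new power of two. *)
theory Submission
  imports Defs
begin

section \<open>Recursive functions\<close>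

text \<open>The exponent s is an arbitrary real, so \<open>2 powr s\<close> may be noncomputable,
  and then the rescaled capital \<open>2 powr ((1 - s) * length w) * d w\<close> of a lower
  semicomputable s-gale has no evident rational approximation. A set of strings remembers of the
  exponent only its growth rate. It can therefore be exploited again at a slightly larger exponent
  whose power of two is a fraction of naturals, and every approximation becomes exact integer
  arithmetic. An infimum does not see the increase. The same slack pays for the weight |v|, which
  turns a bounded gain at infinitely many prefixes into unbounded capital. A gale must satisfy its
  averaging condition with equality, which arbitrary approximations from below would lose. Sums of
  explicit gales keep it at every stage, so it survives the limit.\<close>

definition computable :: "nat \<Rightarrow> (nat list \<Rightarrow> nat) \<Rightarrow> bool" where
  "computable n f \<longleftrightarrow> (\<exists>f'. recfn n f' \<and> (\<forall>xs. length xs = n \<longrightarrow> f xs = f' xs))"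

definition decidable :: "nat \<Rightarrow> (nat list \<Rightarrow> bool) \<Rightarrow> bool" where
  "decidable n P \<longleftrightarrow> computable n (\<lambda>xs. of_bool (P xs))"

lemma recfn_computable: "recfn n f \<Longrightarrow> computable n f"
  by (auto simp: computable_def)

text \<open>The gain over \<open>recfn\<close>: a derivation of \<open>recfn\<close> also fixes
  values on lists of the wrong length, where for instance \<open>hd\<close> and
  \<open>xs ! 0\<close> may differ. Here only lists of length n count, so functions can be rewritten
  freely.\<close>

lemma computable_cong:
  "computable n f \<Longrightarrow> (\<And>xs. length xs = n \<Longrightarrow> f xs = g xs) \<Longrightarrow> computable n g"
  by (metis computable_def)

lemma decidable_cong:
  "decidable n P \<Longrightarrow> (\<And>xs. length xs = n \<Longrightarrow> P xs \<longleftrightarrow> Q xs) \<Longrightarrow> decidable n Q"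
  unfolding decidable_def by (erule computable_cong) simp

lemma computable_map:
  assumes "computable (length gs) f" "\<forall>g\<in>set gs. computable n g"
  shows "computable n (\<lambda>xs. f (map (\<lambda>g. g xs) gs))"
proof -
  obtain f' where f': "recfn (length gs) f'" "\<And>xs. length xs = length gs \<Longrightarrow> f xs = f' xs"
    using assms(1) by (auto simp: computable_def)
  obtain r where r: "\<And>g. g \<in> set gs \<Longrightarrow> recfn n (r g) \<and> (\<forall>xs. length xs = n \<longrightarrow> g xs = r g xs)"
    using assms(2) unfolding computable_def by metis
  have "recfn n (\<lambda>xs. f' (map (\<lambda>g. g xs) (map r gs)))"
    by (rule recfn.comp[OF f'(1)]) (use r in auto)
  moreover have "f (map (\<lambda>g. g xs) gs) = f' (map (\<lambda>g. g xs) (map r gs))" if "length xs = n" for xs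
  proof -
    have "map (\<lambda>g. g xs) gs = map (\<lambda>g. g xs) (map r gs)"
      using r that by auto
    then show ?thesis using f'(2) by (metis length_map)
  qed
  ultimately show ?thesis unfolding computable_def by blast
qed

lemma computable_app1:
  "computable 1 f \<Longrightarrow> computable n F \<Longrightarrow> computable n (\<lambda>xs. f [F xs])"
  using computable_map[of "[F]" f n] by simp

lemma computable_app2:
  "computable 2 f \<Longrightarrow> computable n F \<Longrightarrow> computable n G \<Longrightarrow> computable n (\<lambda>xs. f [F xs, G xs])"
  using computable_map[of "[F, G]" f n] by (simp add: numeral_2_eq_2)

lemma computable_app_curried:
  "computable 2 (\<lambda>xs. f (xs ! 0) (xs ! 1)) \<Longrightarrow> computable n F \<Longrightarrow> computable n G \<Longrightarrow>
    computable n (\<lambda>xs. f (F xs) (G xs))"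
  by (drule computable_app2[of _ n F G]) auto

lemma decidable_app2:
  "decidable 2 (\<lambda>xs. R (xs ! 0) (xs ! 1)) \<Longrightarrow> computable n F \<Longrightarrow> computable n G \<Longrightarrow>
    decidable n (\<lambda>xs. R (F xs) (G xs))"
  unfolding decidable_def by (rule computable_app_curried)

lemma computable_nth: "i < n \<Longrightarrow> computable n (\<lambda>xs. xs ! i)"
  by (intro recfn_computable recfn.proj)

lemma computable_hd: "0 < n \<Longrightarrow> computable n hd"
  by (rule computable_cong[OF computable_nth[of 0]]) (auto simp: hd_conv_nth)

lemma computable_nth_tl: "Suc i < n \<Longrightarrow> computable n (\<lambda>xs. tl xs ! i)"
  by (rule computable_cong[OF computable_nth[of "Suc i"]]) (auto simp: nth_tl)

lemma computable_hd_tl: "1 < n \<Longrightarrow> computable n (\<lambda>xs. hd (tl xs))"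
  by (rule computable_cong[OF computable_nth[of 1]]) (auto simp: hd_drop_conv_nth[of "Suc 0", simplified drop_Suc drop_0])

lemma computable_nth_tl2: "Suc (Suc i) < n \<Longrightarrow> computable n (\<lambda>xs. tl (tl xs) ! i)"
  by (rule computable_cong[OF computable_nth[of "Suc (Suc i)"]]) (auto simp: nth_tl)

lemma computable_Suc: "computable n F \<Longrightarrow> computable n (\<lambda>xs. Suc (F xs))"
  using computable_app1[OF recfn_computable[OF recfn.succ]] by simp

lemma computable_const: "computable n (\<lambda>_. c)"
  by (induction c) (auto intro: computable_Suc recfn_computable recfn.zero)

text \<open>\<open>recfn.prim\<close> recurses on the head of its argument list. To recurse up to an
  arbitrary computable bound \<open>N\<close>, that bound is put in front of the n original
  arguments, which serve as parameters. Writing the step with \<open>hd\<close> and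
  \<open>tl\<close> lets the closure rules apply to it syntactically.\<close>

lemma computable_rec_nat:
  assumes "computable n N" "computable n G" "computable (n + 2) (\<lambda>ys. H (hd ys) (hd (tl ys)) (tl (tl ys)))"
  shows "computable n (\<lambda>xs. rec_nat (G xs) (\<lambda>y r. H y r xs) (N xs))"
proof -
  obtain g where g: "recfn n g" "\<And>xs. length xs = n \<Longrightarrow> G xs = g xs"
    using assms(2) by (auto simp: computable_def)
  obtain h where h: "recfn (n + 2) h"
      "\<And>xs. length xs = n + 2 \<Longrightarrow> H (hd xs) (hd (tl xs)) (tl (tl xs)) = h xs"
    using assms(3) by (auto simp: computable_def)
  define f where "f = (\<lambda>xs. rec_nat (g (tl xs)) (\<lambda>y r. h (y # r # tl xs)) (hd xs))"
  have "computable (Suc n) f"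
    unfolding f_def by (intro recfn_computable recfn.prim g h)
  then have "computable n (\<lambda>xs. f (map (\<lambda>k. k xs) (N # map (\<lambda>i xs. xs ! i) [0..<n])))"
    by (intro computable_map) (auto intro: assms computable_nth)
  then show ?thesis
  proof (rule computable_cong)
    fix xs :: "nat list" assume len: "length xs = n"
    have "map (\<lambda>k. k xs) (map (\<lambda>i xs. xs ! i) [0..<n]) = xs"
      using len map_nth[of xs] by (simp add: comp_def)
    moreover have "H y r xs = h (y # r # xs)" for y r
      using h(2)[of "y # r # xs"] len by simp
    ultimately show "f (map (\<lambda>k. k xs) (N # map (\<lambda>i xs. xs ! i) [0..<n]))
        = rec_nat (G xs) (\<lambda>y r. H y r xs) (N xs)"
      using g(2)[OF len] by (simp add: f_def)
  qed
qed

lemma computable_weaken: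
  assumes "computable n F"
  shows "computable (Suc n) (\<lambda>xs. F (tl xs))"
proof -
  have "computable (Suc n) (\<lambda>xs. F (map (\<lambda>k. k xs) (map (\<lambda>i xs. xs ! Suc i) [0..<n])))"
    by (rule computable_map) (use assms in \<open>auto intro!: computable_nth\<close>)
  then show ?thesis
  proof (rule computable_cong)
    fix xs :: "nat list" assume len: "length xs = Suc n"
    have "map (\<lambda>k. k xs) (map (\<lambda>i xs. xs ! Suc i) [0..<n]) = tl xs"
      using len by (intro nth_equalityI) (auto simp: nth_tl)
    then show "F (map (\<lambda>k. k xs) (map (\<lambda>i xs. xs ! Suc i) [0..<n])) = F (tl xs)" by simp
  qed
qed

lemma computable_weaken2: "computable n F \<Longrightarrow> computable (n + 2) (\<lambda>xs. F (tl (tl xs)))"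
  using computable_weaken[OF computable_weaken] by simp

lemma computable_add:
  assumes "computable n F" "computable n G"
  shows "computable n (\<lambda>xs. F xs + G xs)"
proof -
  have "computable n (\<lambda>xs. rec_nat (F xs) (\<lambda>y r. Suc r) (G xs))"
    by (intro computable_rec_nat assms computable_Suc computable_hd_tl) simp
  moreover have "rec_nat x (\<lambda>y r. Suc r) z = x + z" for x z :: nat
    by (induction z) auto
  ultimately show ?thesis by simp
qed

lemma computable_mult:
  assumes "computable n F" "computable n G"
  shows "computable n (\<lambda>xs. F xs * G xs)"
proof -
  have "computable n (\<lambda>xs. rec_nat 0 (\<lambda>y r. r + F xs) (G xs))"
    by (intro computable_rec_nat assms computable_add computable_hd_tl computable_const
        computable_weaken2) simp
  moreover have "rec_nat 0 (\<lambda>y r. r + x) z = x * z" for x z :: nat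
    by (induction z) auto
  ultimately show ?thesis by simp
qed

lemma computable_power:
  assumes "computable n F" "computable n G"
  shows "computable n (\<lambda>xs. F xs ^ G xs)"
proof -
  have "computable n (\<lambda>xs. rec_nat 1 (\<lambda>y r. r * F xs) (G xs))"
    by (intro computable_rec_nat assms computable_mult computable_hd_tl computable_const
        computable_weaken2) simp
  moreover have "rec_nat 1 (\<lambda>y r. r * x) z = x ^ z" for x z :: nat
    by (induction z) auto
  ultimately show ?thesis by simp
qed

lemma computable_diff:
  assumes "computable n F" "computable n G"
  shows "computable n (\<lambda>xs. F xs - G xs)"
proof -
  have pred: "computable k (\<lambda>xs. F xs - 1)" if "computable k F" for k and F :: "nat list \<Rightarrow> nat"
  proof -
    have "computable k (\<lambda>xs. rec_nat 0 (\<lambda>y r. y) (F xs))"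
      by (intro computable_rec_nat that computable_hd computable_const) simp
    moreover have "rec_nat 0 (\<lambda>y r. y) z = z - 1" for z :: nat
      by (cases z) auto
    ultimately show ?thesis by simp
  qed
  have "computable n (\<lambda>xs. rec_nat (F xs) (\<lambda>y r. r - 1) (G xs))"
    by (intro computable_rec_nat assms pred computable_hd_tl) simp
  moreover have "rec_nat x (\<lambda>y r. r - 1) z = x - z" for x z :: nat
    by (induction z) auto
  ultimately show ?thesis by simp
qed

text \<open>The workhorse for everything that is bounded: counting, quotients, bounded quantifiers
  and the finite stages of gales and learners are all written as sums.\<close>

lemma computable_sum:
  assumes "computable n B" "computable (Suc n) (\<lambda>ys. F (hd ys) (tl ys))"
  shows "computable n (\<lambda>xs. \<Sum>i<B xs. F i xs)"
proof -
  \<comment> \<open>In a primitive recursion the accumulator sits between the index and the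
    parameters; substituting projections removes this slot.\<close>
  have "computable (n + 2) (\<lambda>ys. F (hd ys) (tl (tl ys)))"
  proof -
    have "computable (n + 2) (\<lambda>xs. (\<lambda>ys. F (hd ys) (tl ys))
        (map (\<lambda>k. k xs) ((\<lambda>xs. xs ! 0) # map (\<lambda>i xs. xs ! Suc (Suc i)) [0..<n])))"
      by (rule computable_map) (use assms(2) in \<open>auto intro!: computable_nth\<close>)
    then show ?thesis
    proof (rule computable_cong)
      fix xs :: "nat list" assume len: "length xs = n + 2"
      have "map (\<lambda>k. k xs) (map (\<lambda>i xs. xs ! Suc (Suc i)) [0..<n]) = tl (tl xs)"
        using len by (intro nth_equalityI) (auto simp: nth_tl)
      moreover have "xs ! 0 = hd xs" using len by (cases xs) auto
      ultimately show "(\<lambda>ys. F (hd ys) (tl ys))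
        (map (\<lambda>k. k xs) ((\<lambda>xs. xs ! 0) # map (\<lambda>i xs. xs ! Suc (Suc i)) [0..<n])) =
          F (hd xs) (tl (tl xs))" by simp
    qed
  qed
  then have "computable n (\<lambda>xs. rec_nat 0 (\<lambda>y r. r + F y xs) (B xs))"
    by (intro computable_rec_nat assms(1) computable_add computable_hd_tl computable_const) simp_all
  moreover have "rec_nat 0 (\<lambda>y r. r + f y) z = (\<Sum>i<z. f i)" for f :: "nat \<Rightarrow> nat" and z
    by (induction z) auto
  ultimately show ?thesis by simp
qed

lemma computable_of_bool: "decidable n P \<Longrightarrow> computable n (\<lambda>xs. of_bool (P xs))"
  by (simp add: decidable_def)

lemma decidable_le:
  assumes "computable n F" "computable n G"
  shows "decidable n (\<lambda>xs. F xs \<le> G xs)"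
proof -
  have "computable n (\<lambda>xs. 1 - (F xs - G xs))"
    by (intro assms computable_diff computable_const)
  then show ?thesis
    unfolding decidable_def by (rule computable_cong) auto
qed

lemma decidable_conj:
  assumes "decidable n P" "decidable n Q"
  shows "decidable n (\<lambda>xs. P xs \<and> Q xs)"
  using assms unfolding decidable_def of_bool_conj by (rule computable_mult)

lemma decidable_less:
  "computable n F \<Longrightarrow> computable n G \<Longrightarrow> decidable n (\<lambda>xs. F xs < G xs)"
  unfolding less_eq_Suc_le by (intro decidable_le computable_Suc)

lemma decidable_eq:
  "computable n F \<Longrightarrow> computable n (G :: _ \<Rightarrow> nat) \<Longrightarrow> decidable n (\<lambda>xs. F xs = G xs)"
  unfolding order_eq_iff by (intro decidable_conj decidable_le)

lemma decidable_bex: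
  assumes "computable n B" "decidable (Suc n) (\<lambda>ys. P (hd ys) (tl ys))"
  shows "decidable n (\<lambda>xs. \<exists>i<B xs. P i xs)"
proof -
  have "decidable n (\<lambda>xs. 0 < (\<Sum>i<B xs. of_bool (P i xs) :: nat))"
    by (intro decidable_less computable_const computable_sum computable_of_bool assms)
  then show ?thesis
    by (rule decidable_cong) (auto simp: card_gt_0_iff)
qed

lemma computable_If:
  assumes "decidable n P" "computable n F" "computable n G"
  shows "computable n (\<lambda>xs. if P xs then F xs else G xs)"
proof -
  have "computable n (\<lambda>xs. of_bool (P xs) * F xs + (1 - of_bool (P xs)) * G xs)"
    by (intro assms computable_add computable_mult computable_diff computable_const computable_of_bool)
  then show ?thesis by (rule computable_cong) auto
qed

lemma computable_mod:
  assumes "computable n F" "computable n G"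
  shows "computable n (\<lambda>xs. F xs mod G xs)"
proof -
  \<comment> \<open>The sum counts the positive multiples of the divisor up to \<open>F xs\<close>,
    which is the quotient. For divisor 0 the product vanishes, in accordance with
    \<open>x mod 0 = x\<close>.\<close>
  have "computable n (\<lambda>xs. F xs - G xs * (\<Sum>j<F xs. of_bool (Suc j * G xs \<le> F xs)))"
    by (intro computable_diff computable_mult computable_sum assms computable_of_bool decidable_le
        computable_Suc computable_hd computable_weaken) simp_all
  moreover have "x - y * (\<Sum>j<x. of_bool (Suc j * y \<le> x)) = x mod y" for x y :: nat
  proof (cases "y = 0")
    case False
    then have "{j \<in> {..<x}. Suc j * y \<le> x} = {..<x div y}"
      by (auto simp: less_eq_Suc_le[of _ "x div y"] less_eq_div_iff_mult_less_eq
          intro: order.strict_trans2[OF _ div_le_dividend])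
    then have "(\<Sum>j<x. of_bool (Suc j * y \<le> x)) = x div y"
      by (simp flip: sum.inter_filter add: of_bool_def)
    then show ?thesis by (simp add: minus_mult_div_eq_mod)
  qed auto
  ultimately show ?thesis by simp
qed

lemmas computable_intros =
  computable_const computable_nth computable_hd computable_nth_tl computable_hd_tl computable_nth_tl2
  computable_Suc computable_add computable_mult computable_power computable_diff computable_sum
  computable_of_bool computable_If computable_mod
  decidable_le decidable_less decidable_eq decidable_conj decidable_bex

section \<open>Length and prefixes of strings computed from their codes\<close>

lemma bits_code_Suc: "bits_code w + 1 < 2 ^ Suc (length w) \<and> 2 ^ length w \<le> bits_code w + 1"
  by (induction w) auto

lemma length_le_bits_code: "length w \<le> bits_code w"
  by (induction w) auto

lemma inj_bits_code: "inj bits_code"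
proof (rule injI)
  fix v w show "bits_code v = bits_code w \<Longrightarrow> v = w"
  proof (induction v arbitrary: w)
    case Nil
    then show ?case by (cases w) (auto split: if_split_asm)
  next
    case (Cons b v)
    then obtain c w' where w: "w = c # w'" by (cases w; cases b) auto
    then have "b = c" using Cons.prems by (auto split: if_splits) presburger+
    then show ?case using Cons w by auto
  qed
qed

lemma surj_bits_code: "\<exists>w. bits_code w = n"
proof (induction n rule: less_induct)
  case (less n)
  show ?case
  proof (cases "n = 0")
    case False
    then obtain w where w: "bits_code w = (n - 1) div 2"
      using less.IH[of "(n - 1) div 2"] by force
    have "bits_code (even n # w) = n"
      using False w by (auto elim!: evenE oddE)
    then show ?thesis ..
  qed (auto intro: exI[of _ "[]"])
qed

text \<open>In binary, \<open>bits_code w + 1\<close> is a leading 1 followed by the reversal of \<open>w\<close>.\<close>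

definition code_length :: "nat \<Rightarrow> nat" where
  "code_length n = (\<Sum>j<n. of_bool (2 ^ Suc j \<le> Suc n))"

definition code_take :: "nat \<Rightarrow> nat \<Rightarrow> nat" where
  "code_take j n = 2 ^ j + Suc n mod 2 ^ j - 1"

lemma code_length_bits_code [simp]: "code_length (bits_code w) = length w"
proof -
  have "{j \<in> {..<bits_code w}. (2::nat) ^ Suc j \<le> Suc (bits_code w)} = {..<length w}"
  proof (intro equalityI subsetI)
    fix j assume "j \<in> {j \<in> {..<bits_code w}. (2::nat) ^ Suc j \<le> Suc (bits_code w)}"
    then have "2 ^ Suc j \<le> bits_code w + 1" by simp
    also have "\<dots> < 2 ^ Suc (length w)" using bits_code_Suc by blast
    finally have "(2::nat) ^ Suc j < 2 ^ Suc (length w)" .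
    then have "Suc j < Suc (length w)" by (rule power_less_imp_less_exp[rotated]) simp
    then show "j \<in> {..<length w}" by simp
  next
    fix j assume "j \<in> {..<length w}"
    then have j: "j < length w" by simp
    then have "2 ^ Suc j \<le> (2::nat) ^ length w" by (intro power_increasing) auto
    also have "\<dots> \<le> bits_code w + 1" using bits_code_Suc by blast
    finally show "j \<in> {j \<in> {..<bits_code w}. (2::nat) ^ Suc j \<le> Suc (bits_code w)}"
      using j length_le_bits_code[of w] by (simp del: power_Suc)
  qed
  then show ?thesis unfolding code_length_def
    by (simp flip: sum.inter_filter add: of_bool_def del: power_Suc)
qed

text \<open>The first bit of a string is the lowest binary digit of its code plus one. Hence a
  prefix of length j consists of the j lowest digits, and \<open>2 ^ j\<close> puts the leading 1
  back.\<close>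

lemma code_take_bits_code: "j \<le> length w \<Longrightarrow> code_take j (bits_code w) = bits_code (take j w)"
proof -
  have "2 ^ j + (bits_code w + 1) mod 2 ^ j = bits_code (take j w) + 1" if "j \<le> length w" for j
    using that
  proof (induction w arbitrary: j)
    case (Cons b w)
    show ?case
    proof (cases j)
      case (Suc i)
      then have IH: "2 ^ i + (bits_code w + 1) mod 2 ^ i = bits_code (take i w) + 1"
        using Cons by simp
      have "(2 * x + of_bool b) mod 2 ^ Suc i = 2 * (x mod 2 ^ i) + of_bool b" for x :: nat
        using mod_mult2_eq[of "2 * x + of_bool b" 2 "2 ^ i"] by (cases b) auto
      from this[of "bits_code w + 1"] show ?thesis using IH Suc by auto
    qed simp
  qed simp
  from this[of j] show "j \<le> length w \<Longrightarrow> code_take j (bits_code w) = bits_code (take j w)"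
    unfolding code_take_def by simp
qed

lemma computable_code_length: "computable n F \<Longrightarrow> computable n (\<lambda>xs. code_length (F xs))"
  unfolding code_length_def
  by (intro computable_intros computable_weaken) simp_all

lemma computable_code_take:
  "computable n F \<Longrightarrow> computable n G \<Longrightarrow> computable n (\<lambda>xs. code_take (F xs) (G xs))"
  unfolding code_take_def by (intro computable_intros) simp_all

section \<open>Lower semicomputability in terms of two-argument number functions\<close>

lemma lower_semicomputableI:
  assumes "computable 2 (\<lambda>xs. p (xs ! 0) (xs ! 1))" "computable 2 (\<lambda>xs. q (xs ! 0) (xs ! 1))"
    and g: "\<And>w t. g w t = real (p (bits_code w) t) / real (q (bits_code w) t + 1)"
    and "\<And>w t. g w t \<le> g w (Suc t)" "\<And>w. (\<lambda>t. g w t) \<longlonglongrightarrow> f w"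
  shows "lower_semicomputable f"
proof -
  have le: "g w t \<le> f w" for w t
    using assms(4) by (intro incseq_le[OF incseq_SucI assms(5)])
  obtain p' where p': "recfn 2 p'" "\<And>x t. p x t = p' [x, t]"
  proof -
    obtain p' where "recfn 2 p'" "\<And>xs. length xs = 2 \<Longrightarrow> p (xs ! 0) (xs ! 1) = p' xs"
      using assms(1) by (auto simp: computable_def)
    from this(1) this(2)[of "[_, _]"] show thesis by (intro that) auto
  qed
  obtain q' where q': "recfn 2 q'" "\<And>x t. q x t = q' [x, t]"
  proof -
    obtain q' where "recfn 2 q'" "\<And>xs. length xs = 2 \<Longrightarrow> q (xs ! 0) (xs ! 1) = q' xs"
      using assms(2) by (auto simp: computable_def)
    from this(1) this(2)[of "[_, _]"] show thesis by (intro that) auto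
  qed
  define G where "G = (\<lambda>w t. of_nat (p' [bits_code w, t]) / of_nat (q' [bits_code w, t] + 1) :: rat)"
  have "computable_rat G"
    unfolding computable_rat_def G_def using p' q' by auto
  moreover have "real_of_rat (G w t) = g w t" for w t
    by (simp add: G_def g p' q' of_rat_divide of_rat_add)
  ultimately show ?thesis
    unfolding lower_semicomputable_def using assms le by (intro exI[of _ G]) auto
qed

lemma lower_semicomputableE:
  assumes "lower_semicomputable f"
  obtains p q g where
    "computable 2 (\<lambda>xs. p (xs ! 0) (xs ! 1))" "computable 2 (\<lambda>xs. q (xs ! 0) (xs ! 1))"
    "\<And>w t. g w t = real (p (bits_code w) t) / real (q (bits_code w) t + 1)"
    "\<And>w t. g w t \<le> g w (Suc t)" "\<And>w t. g w t \<le> f w" "\<And>w. (\<lambda>t. g w t) \<longlonglongrightarrow> f w"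
proof -
  obtain G where G: "computable_rat G" "\<And>w t. real_of_rat (G w t) \<le> real_of_rat (G w (Suc t))"
     "\<And>w t. real_of_rat (G w t) \<le> f w" "\<And>w. (\<lambda>t. real_of_rat (G w t)) \<longlonglongrightarrow> f w"
    using assms unfolding lower_semicomputable_def by auto
  obtain p q where pq: "recfn 2 p" "recfn 2 q"
      "\<And>w t. G w t = of_nat (p [bits_code w, t]) / of_nat (q [bits_code w, t] + 1)"
    using G(1) unfolding computable_rat_def by auto
  have two: "[xs ! 0, xs ! 1] = xs" if "length xs = 2" for xs :: "nat list"
    using that by (intro nth_equalityI) (auto simp: less_Suc_eq)
  show thesis
  proof (rule that[of "\<lambda>x t. p [x, t]" "\<lambda>x t. q [x, t]" "\<lambda>w t. real_of_rat (G w t)"])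
    show "computable 2 (\<lambda>xs. p [xs ! 0, xs ! 1])"
      by (rule computable_cong[OF recfn_computable[OF pq(1)]]) (simp add: two[simplified])
    show "computable 2 (\<lambda>xs. q [xs ! 0, xs ! 1])"
      by (rule computable_cong[OF recfn_computable[OF pq(2)]]) (simp add: two[simplified])
  qed (use G pq(3) in \<open>auto simp: of_rat_divide of_rat_add\<close>)
qed

section \<open>Gales from sparse enumerable sets\<close>

text \<open>The c.e. sets, with \<open>R n t\<close> read as "n has been listed by stage t".
  Monotonicity in t is built in because sums over the strings listed so far have to increase with
  the stage.\<close>

definition enumerable :: "bool list set \<Rightarrow> bool" where
  "enumerable A \<longleftrightarrow> (\<exists>R. decidable 2 (\<lambda>xs. R (xs ! 0) (xs ! 1)) \<and>
     (\<forall>n t. R n t \<longrightarrow> R n (Suc t)) \<and> A = {w. \<exists>t. R (bits_code w) t})"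

text \<open>The inequality is strict, so a limit above the threshold is witnessed by the
  approximation at some finite stage; at a given stage two fractions are compared by
  cross-multiplication.\<close>

lemma enumerable_superlevel:
  assumes "lower_semicomputable f" "b > 0"
  shows "enumerable {w. f w > real a / real b}"
proof -
  obtain p q g where pq:
    "computable 2 (\<lambda>xs. p (xs ! 0) (xs ! 1))" "computable 2 (\<lambda>xs. q (xs ! 0) (xs ! 1))"
    and g: "\<And>w t. g w t = real (p (bits_code w) t) / real (q (bits_code w) t + 1)"
    "\<And>w t. g w t \<le> g w (Suc t)" "\<And>w t. g w t \<le> f w" "\<And>w. (\<lambda>t. g w t) \<longlonglongrightarrow> f w"
    by (rule lower_semicomputableE[OF assms(1)]) (rule that)
  define R where "R = (\<lambda>n t. a * (q n t + 1) < p n t * b)"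
  have R: "R (bits_code w) t \<longleftrightarrow> real a / real b < g w t" for w t
  proof -
    have "R (bits_code w) t \<longleftrightarrow>
        real (a * (q (bits_code w) t + 1)) < real (p (bits_code w) t * b)"
      unfolding R_def of_nat_less_iff ..
    also have "\<dots> \<longleftrightarrow> real a / real b < g w t"
      unfolding g(1) of_nat_mult using assms(2)
      by (subst frac_less_eq) (auto simp: divide_simps mult.commute)
    finally show ?thesis .
  qed
  have "R n t \<Longrightarrow> R n (Suc t)" for n t
    using R g(2) surj_bits_code[of n] by (metis order.strict_trans2)
  moreover have "decidable 2 (\<lambda>xs. R (xs ! 0) (xs ! 1))"
    unfolding R_def by (intro computable_intros pq)
  moreover have "f w > real a / real b \<longleftrightarrow> (\<exists>t. R (bits_code w) t)" for w
  proof
    assume "f w > real a / real b"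
    then have "eventually (\<lambda>t. g w t > real a / real b) sequentially"
      using g(4) order_tendstoD(1) by blast
    then show "\<exists>t. R (bits_code w) t" unfolding R by (auto simp: eventually_sequentially)
  qed (use R g(3) in \<open>auto intro: order.strict_trans2\<close>)
  ultimately show ?thesis unfolding enumerable_def by auto
qed

lemma is_gale_iff:
  "is_gale t d \<longleftrightarrow> (\<forall>w. d w \<ge> 0) \<and> (\<forall>w. d (w @ [False]) + d (w @ [True]) = 2 powr t * d w)"
proof -
  have "d w * 2 powr (- t * real (length w)) = x * 2 powr (- t * real (length w + 1))
      + y * 2 powr (- t * real (length w + 1)) \<longleftrightarrow> x + y = 2 powr t * d w" for w x y
  proof -
    have e: "2 powr (- t * real (length w + 1)) = 2 powr (- t * real (length w)) / 2 powr t"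
    proof -
      have "- t * real (length w + 1) = - t * real (length w) - t" by (simp add: algebra_simps)
      then show ?thesis by (simp only: powr_diff)
    qed
    have "d w * 2 powr (- t * real (length w)) = x * 2 powr (- t * real (length w + 1))
      + y * 2 powr (- t * real (length w + 1)) \<longleftrightarrow>
      d w * 2 powr (- t * real (length w)) = ((x + y) / 2 powr t) * 2 powr (- t * real (length w))"
      unfolding e by (simp add: field_simps)
    also have "\<dots> \<longleftrightarrow> d w = (x + y) / 2 powr t"
      unfolding mult_cancel_right by simp
    also have "\<dots> \<longleftrightarrow> x + y = 2 powr t * d w"
      by (auto simp: field_simps)
    finally show ?thesis .
  qed
  then show ?thesis unfolding is_gale_def by (simp only:)
qed

text \<open>The sibling has nonnegative capital, so one child receives at most everything the parent
  passes on. A bound at the empty string thus bounds the gale at each string.\<close>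

lemma gale_le_power:
  assumes "is_gale t d"
  shows "d w \<le> (2 powr t) ^ length w * d []"
proof (induction w rule: rev_induct)
  case (snoc b w)
  have "d (w @ [b]) \<le> 2 powr t * d w"
    using assms unfolding is_gale_iff by (cases b) (metis le_add_same_cancel1 le_add_same_cancel2)+
  also have "\<dots> \<le> 2 powr t * ((2 powr t) ^ length w * d [])"
    using snoc by simp
  finally show ?case by (simp add: mult_ac)
qed simp

text \<open>A gale with value 1 at \<open>v\<close> that is supported on the strings comparable with \<open>v\<close>:
  it bets everything on \<open>v\<close> up to \<open>v\<close> and splits evenly afterwards.\<close>

definition spike :: "real \<Rightarrow> bool list \<Rightarrow> bool list \<Rightarrow> real" where
  "spike \<rho> v w =
    (if take (length v) w = v then (\<rho> / 2) ^ (length w - length v)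
     else if take (length w) v = w then \<rho> ^ length w / \<rho> ^ length v else 0)"

lemma spike_nonneg: "\<rho> > 0 \<Longrightarrow> spike \<rho> v w \<ge> 0"
  by (simp add: spike_def)

text \<open>Beyond v each child gets the factor \<open>\<rho> / 2\<close>; strictly before v only
  the child towards v has capital; at strings incomparable with v all three values vanish.\<close>

lemma spike_gale:
  assumes "\<rho> > 0"
  shows "spike \<rho> v (w @ [False]) + spike \<rho> v (w @ [True]) = \<rho> * spike \<rho> v w"
proof (cases "take (length v) w = v")
  case True
  then have "length v \<le> length w" by (metis length_take min.cobounded1 min.commute)
  then show ?thesis using True by (simp add: spike_def Suc_diff_le)
next
  case notpre: False
  show ?thesis
  proof (cases "take (length w) v = w")
    case True
    then obtain v' where v: "v = w @ v'" by (metis append_take_drop_id)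
    then obtain c v'' where v'': "v = w @ c # v''" using notpre by (cases v') auto
    then show ?thesis using assms
      by (cases c) (auto simp: spike_def field_simps)
  next
    case False
    have "spike \<rho> v (w @ [b]) = 0" for b
    proof -
      have "take (length v) (w @ [b]) \<noteq> v"
        using notpre False by (cases "length v \<le> length w") auto
      moreover have "take (length (w @ [b])) v \<noteq> w @ [b]"
        using False by (metis append_eq_conv_conj append_take_drop_id append_assoc)
      ultimately show ?thesis by (simp add: spike_def)
    qed
    then show ?thesis using notpre False by (simp add: spike_def)
  qed
qed

lemma finite_length_eq: "finite {w :: bool list. P w \<and> length w = n}"
  using finite_lists_length_eq[of "UNIV :: bool set" n] by (rule finite_subset[rotated]) auto

text \<open>A spike at v costs \<open>1 / \<rho> ^ length v\<close> at the empty string, so the sum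
  is the initial capital of all spikes weighted by length. Grouped by length it is dominated by C
  times the series of (n + 1) x^n with x = \<open>2 powr s / \<rho>\<close> < 1, the derivative of
  the geometric series.\<close>

lemma sum_over_sparse_set_bounded:
  fixes A :: "bool list set"
  assumes "\<rho> > 2 powr s" "\<And>n. card {w \<in> A. length w = n} \<le> C * 2 powr (s * real n)"
  obtains B where "\<And>S. finite S \<Longrightarrow> S \<subseteq> A \<Longrightarrow> (\<Sum>v\<in>S. real (length v) / \<rho> ^ length v) \<le> B"
proof
  define x where "x = 2 powr s / \<rho>"
  have rho: "\<rho> > 0" using assms(1) by (rule order.strict_trans[rotated]) simp
  have x: "0 \<le> x" "x < 1" using assms(1) rho by (auto simp: x_def)
  have C: "C \<ge> 0" using order_trans[OF of_nat_0_le_iff assms(2)[of 0]] by simp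
  fix S assume S: "finite S" "S \<subseteq> A"
  define N where "N = Suc (Max (insert 0 (length ` S)))"
  have "length v < N" if "v \<in> S" for v
    unfolding N_def less_Suc_eq_le using S that by (intro Max_ge) auto
  then have "(\<Sum>v\<in>S. real (length v) / \<rho> ^ length v) =
      (\<Sum>n<N. \<Sum>v\<in>{v \<in> S. length v = n}. real (length v) / \<rho> ^ length v)"
    using S by (intro sum.group[symmetric]) auto
  also have "\<dots> = (\<Sum>n<N. real (card {v \<in> S. length v = n}) * (real n / \<rho> ^ n))"
    by (intro sum.cong refl) simp
  also have "\<dots> \<le> (\<Sum>n<N. C * (real (Suc n) * x ^ n))"
  proof (rule sum_mono)
    fix n
    have "real (card {v \<in> S. length v = n}) \<le> real (card {w \<in> A. length w = n})"
      using S(2) by (intro of_nat_mono card_mono finite_length_eq) auto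
    also have "\<dots> \<le> C * (2 powr s) ^ n"
      using assms(2)[of n] by (simp add: powr_realpow[symmetric] powr_powr)
    finally have "real (card {v \<in> S. length v = n}) * (real n / \<rho> ^ n) \<le>
        (C * (2 powr s) ^ n) * (real (Suc n) / \<rho> ^ n)"
      using rho C by (intro mult_mono divide_right_mono) auto
    then show "real (card {v \<in> S. length v = n}) * (real n / \<rho> ^ n) \<le> C * (real (Suc n) * x ^ n)"
      by (simp add: x_def power_divide mult_ac)
  qed
  also have "\<dots> = C * (\<Sum>n<N. real (Suc n) * x ^ n)"
    by (simp add: sum_distrib_left)
  also have "\<dots> \<le> C * (1 / (1 - x)\<^sup>2)"
  proof (intro mult_left_mono C)
    have "(\<lambda>n. real (Suc n) * x ^ n) sums (1 / (1 - x)\<^sup>2)"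
      using geometric_deriv_sums[of x] x by simp
    from sum_le_suminf[OF sums_summable[OF this], of "{..<N}"] sums_unique[OF this]
    show "(\<Sum>n<N. real (Suc n) * x ^ n) \<le> 1 / (1 - x)\<^sup>2" using x by simp
  qed
  finally show "(\<Sum>v\<in>S. real (length v) / \<rho> ^ length v) \<le> C * (1 / (1 - 2 powr s / \<rho>)\<^sup>2)"
    unfolding x_def .
qed

text \<open>The numerator of \<open>spike\<close> for \<open>\<rho>\<close> = a / b over the
  denominator \<open>(2 * b) ^ length w * a ^ t\<close>. The first factor clears
  \<open>(\<rho> / 2) ^ k\<close> and \<open>\<rho> ^ length w\<close>, the second clears
  \<open>1 / \<rho> ^ length v\<close> when \<open>length v \<le> t\<close>. As the denominator does
  not depend on v, sums of spikes become sums of naturals.\<close>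

definition code_spike :: "nat \<Rightarrow> nat \<Rightarrow> nat \<Rightarrow> nat \<Rightarrow> nat \<Rightarrow> nat" where
  "code_spike a b t i n =
    (if code_length i \<le> code_length n \<and> code_take (code_length i) n = i
     then a ^ (code_length n - code_length i) * (2 * b) ^ code_length i * a ^ t
     else if code_length n \<le> code_length i \<and> code_take (code_length n) i = n
     then (2 * a) ^ code_length n * b ^ code_length i * a ^ (t - code_length i) else 0)"

lemma code_spike:
  assumes ab: "a > 0" "b > 0" and t: "length v \<le> t"
  shows "real (code_spike a b t (bits_code v) (bits_code w)) / real ((2 * b) ^ length w * a ^ t) =
    spike (real a / real b) v w"
proof -
  \<comment> \<open>Beyond the length of the string \<open>code_take\<close> no longer computes
    \<open>take\<close> and could produce the code of an unrelated string; the length tests in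
    \<open>code_spike\<close> exclude this.\<close>
  have eq: "length v \<le> length w \<and> code_take (length v) (bits_code w) = bits_code v \<longleftrightarrow>
      take (length v) w = v" for v w
    using inj_bits_code
    by (metis code_take_bits_code injD length_take min.cobounded1 min.commute)
  consider (ext) "take (length v) w = v" | (pre) "take (length v) w \<noteq> v" "take (length w) v = w"
    | (neither) "take (length v) w \<noteq> v" "take (length w) v \<noteq> w" by blast
  then show ?thesis
  proof cases
    case ext
    then have le: "length v \<le> length w" by (metis length_take min.cobounded1 min.commute)
    then have "(2 * real b) ^ length w = (2 * real b) ^ (length w - length v) * (2 * real b) ^ length v"
      using power_add[of "2 * real b" "length w - length v" "length v"] by simp
    then show ?thesis using ext ab unfolding code_spike_def spike_def code_length_bits_code eq
      by (simp add: power_divide power_mult_distrib field_simps)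
  next
    case pre
    have "real a ^ t = real a ^ (t - length v) * real a ^ length v"
      using t by (simp flip: power_add)
    then show ?thesis using pre ab unfolding code_spike_def spike_def code_length_bits_code eq
      by (simp add: power_divide power_mult_distrib field_simps)
  next
    case neither
    then show ?thesis unfolding code_spike_def spike_def code_length_bits_code eq by simp
  qed
qed

lemma gale_of_sparse_set:
  assumes A: "enumerable A" "\<And>n. card {w \<in> A. length w = n} \<le> C * 2 powr (s * real n)"
    and ab: "a > 0" "b > 0" "2 powr t = real a / real b" and st: "s < t"
  obtains d where "lower_semicomputable d" "is_gale t d" "\<And>w. w \<in> A \<Longrightarrow> real (length w) \<le> d w"
proof -
  define \<rho> where "\<rho> = real a / real b"
  have rho: "\<rho> > 0" "\<rho> > 2 powr s" using ab st by (auto simp: \<rho>_def simp flip: ab(3))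
  obtain B where B: "\<And>S. finite S \<Longrightarrow> S \<subseteq> A \<Longrightarrow> (\<Sum>v\<in>S. real (length v) / \<rho> ^ length v) \<le> B"
    using sum_over_sparse_set_bounded[OF rho(2) A(2)] by blast
  obtain R where R: "decidable 2 (\<lambda>xs. R (xs ! 0) (xs ! 1))" "\<And>n u. R n u \<Longrightarrow> R n (Suc u)"
      "A = {w. \<exists>u. R (bits_code w) u}"
    using A(1) unfolding enumerable_def by blast
  define str where "str = inv bits_code"
  have str: "bits_code (str i) = i" for i
    unfolding str_def using surj_bits_code by (intro f_inv_into_f) (metis rangeI)
  \<comment> \<open>The stage u bounds both the codes considered and the time of enumeration. Codes
    below u belong to strings of length at most u, as the common denominator requires.\<close>
  define g where "g = (\<lambda>w u. \<Sum>i<u. of_bool (R i u) * (real (length (str i)) * spike \<rho> (str i) w))"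
  define p where "p = (\<lambda>n u. \<Sum>i<u. of_bool (R i u) * (code_length i * code_spike a b u i n))"
  \<comment> \<open>Rational approximations have denominators of the form q + 1, whence the
    subtraction; the product is positive, so truncation does no harm.\<close>
  define q where "q = (\<lambda>n u. (2 * b) ^ code_length n * a ^ u - 1)"
  have nonneg: "0 \<le> of_bool (R i u) * (real (length (str i)) * spike \<rho> (str i) w)" for i u w
    using spike_nonneg[OF rho(1)] by simp
  \<comment> \<open>Every approximation is itself a gale, so its value at the empty string bounds all others and
    the gale equation passes to the limit.\<close>
  have gale: "is_gale t (\<lambda>w. g w u)" for u
    unfolding is_gale_iff ab(3) \<rho>_def[symmetric]
  proof (intro conjI allI)
    fix w
    show "0 \<le> g w u" unfolding g_def by (intro sum_nonneg nonneg)
    show "g (w @ [False]) u + g (w @ [True]) u = \<rho> * g w u"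
      unfolding g_def sum_distrib_left sum.distrib[symmetric]
      by (intro sum.cong refl)
         (simp only: distrib_left[symmetric] spike_gale[OF rho(1)] mult_ac)
  qed
  have g_mono: "g w u \<le> g w (Suc u)" for w u
    unfolding g_def sum.lessThan_Suc
    by (intro add_increasing2 nonneg sum_mono mult_right_mono mult_nonneg_nonneg
        spike_nonneg rho(1)) (use R(2) in auto)
  have bound: "g [] u \<le> B" for u
  proof -
    have "g [] u = (\<Sum>i\<in>{i \<in> {..<u}. R i u}. real (length (str i)) / \<rho> ^ length (str i))"
      unfolding g_def sum.inter_filter[OF finite_lessThan]
      by (intro sum.cong refl) (simp add: spike_def)
    also have "\<dots> = (\<Sum>v\<in>str ` {i \<in> {..<u}. R i u}. real (length v) / \<rho> ^ length v)"
      by (intro sum.reindex_cong[symmetric, where l = str] inj_onI) (metis str, auto)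
    also have "\<dots> \<le> B" using R(3) by (intro B) (auto simp: str)
    finally show ?thesis .
  qed
  have lim: "\<exists>l. (\<lambda>u. g w u) \<longlonglongrightarrow> l" for w
  proof -
    have "g w u \<le> \<rho> ^ length w * B" for u
      using gale_le_power[OF gale, of w u] bound[of u] rho(1)
      by (auto simp: ab(3) simp flip: \<rho>_def intro: order_trans mult_left_mono)
    then show ?thesis
      using incseq_convergent[OF incseq_SucI[of "g w"]] g_mono by metis
  qed
  then obtain d where d: "\<And>w. (\<lambda>u. g w u) \<longlonglongrightarrow> d w" by metis
  have g_le: "g w u \<le> d w" for w u
    by (intro incseq_le[OF incseq_SucI d] g_mono)
  show thesis
  proof
    show "lower_semicomputable d"
    proof (rule lower_semicomputableI[where p = p and q = q, OF _ _ _ g_mono d])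
      show "computable 2 (\<lambda>xs. p (xs ! 0) (xs ! 1))" unfolding p_def code_spike_def
        by (intro computable_intros decidable_app2[OF R(1)] computable_code_take computable_code_length)
           simp_all
      show "computable 2 (\<lambda>xs. q (xs ! 0) (xs ! 1))" unfolding q_def
        by (intro computable_intros computable_code_length) simp_all
      fix w :: "bool list" and u
      define D where "D = (2 * b) ^ length w * a ^ u"
      have "D > 0" using ab by (simp add: D_def)
      then have q: "q (bits_code w) u + 1 = D" by (simp add: q_def D_def)
      have "g w u = (\<Sum>i<u. real (of_bool (R i u) * (code_length i * code_spike a b u i (bits_code w))) / real D)"
        unfolding g_def
      proof (intro sum.cong refl)
        fix i assume "i \<in> {..<u}"
        then have "length (str i) \<le> u" using length_le_bits_code[of "str i"] by (simp add: str)
        from code_spike[OF ab(1,2) this, of w]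
        have "spike \<rho> (str i) w = real (code_spike a b u i (bits_code w)) / real D"
          unfolding D_def \<rho>_def by (simp add: str)
        then show "of_bool (R i u) * (real (length (str i)) * spike \<rho> (str i) w) =
          real (of_bool (R i u) * (code_length i * code_spike a b u i (bits_code w))) / real D"
          using code_length_bits_code[of "str i"] by (simp add: str)
      qed
      then show "g w u = real (p (bits_code w) u) / real (q (bits_code w) u + 1)"
        unfolding q p_def of_nat_sum sum_divide_distrib .
    qed
    show "is_gale t d" unfolding is_gale_iff
    proof (intro conjI allI)
      fix w
      show "0 \<le> d w" using gale by (intro LIMSEQ_le_const[OF d]) (auto simp: is_gale_iff)
      have "(\<lambda>u. g (w @ [False]) u + g (w @ [True]) u) \<longlonglongrightarrow> 2 powr t * d w"
        using tendsto_mult_left[OF d, of "2 powr t" w] gale by (simp add: is_gale_iff)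
      then show "d (w @ [False]) + d (w @ [True]) = 2 powr t * d w"
        using tendsto_add[OF d d] LIMSEQ_unique by blast
    qed
    fix w assume "w \<in> A"
    then obtain u0 where u0: "R (bits_code w) u0" using R(3) by auto
    \<comment> \<open>A stage at which w has been enumerated and its code lies in the range of
      summation; the spike at w then contributes |w| at w itself.\<close>
    define u where "u = max u0 (Suc (bits_code w))"
    have "R (bits_code w) u"
      by (rule dec_induct[of u0 u]) (use u0 R(2) in \<open>auto simp: u_def\<close>)
    moreover have "str (bits_code w) = w"
      using injD[OF inj_bits_code] str by blast
    ultimately have "real (length w) = of_bool (R (bits_code w) u) *
        (real (length (str (bits_code w))) * spike \<rho> (str (bits_code w)) w)"
      by (simp add: spike_def)
    also have "\<dots> \<le> g w u"
      unfolding g_def by (rule member_le_sum) (use nonneg in \<open>auto simp: u_def\<close>)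
    finally show "real (length w) \<le> d w" using g_le order_trans by blast
  qed
qed

section \<open>Learners\<close>

lemma length_prefix [simp]: "length (prefix Y n) = n"
  by (simp add: prefix_def)

lemma take_prefix: "i \<le> n \<Longrightarrow> take i (prefix Y n) = prefix Y i"
  by (simp add: prefix_def take_map)

section \<open>Uniform measure of events decided by finitely many bits\<close>

lemma cylinder_unif:
  assumes "length w = n"
  shows "{Y. prefix Y n = w} \<in> sets unif" "emeasure unif {Y. prefix Y n = w} = ennreal ((1/2) ^ n)"
proof -
  interpret product_prob_space "\<lambda>_::nat. measure_pmf (bernoulli_pmf (1/2))" UNIV
    by (intro product_prob_spaceI measure_pmf.prob_space_axioms)
  let ?M = "\<lambda>_::nat. measure_pmf (bernoulli_pmf (1/2))"
  have "(prefix Y n = w) \<longleftrightarrow> (\<forall>i<n. Y i = w ! i)" for Y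
    using assms by (auto simp: prefix_def list_eq_iff_nth_eq)
  then have eq: "{Y. prefix Y n = w} = prod_emb UNIV ?M {..<n} (\<Pi>\<^sub>E i\<in>{..<n}. {w ! i})"
    by (auto simp: prod_emb_def space_PiM PiE_iff restrict_def extensional_def)
  show "{Y. prefix Y n = w} \<in> sets unif"
    unfolding eq unif_def by (intro sets_PiM_I) auto
  have "emeasure unif {Y. prefix Y n = w} =
      (\<Prod>i<n. emeasure (measure_pmf (bernoulli_pmf (1/2))) {w ! i})"
    unfolding eq unif_def by (rule emeasure_PiM_emb) auto
  also have "\<dots> = (\<Prod>i<n. ennreal (1/2))"
  proof (intro prod.cong refl)
    fix i
    have "pmf (bernoulli_pmf (1/2)) (w ! i) = 1/2" by (cases "w ! i") auto
    then show "emeasure (measure_pmf (bernoulli_pmf (1/2))) {w ! i} = ennreal (1/2)"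
      by (simp add: emeasure_pmf_single)
  qed
  also have "\<dots> = ennreal ((1/2) ^ n)"
    by (simp only: prod_constant card_lessThan) (rule ennreal_power, simp)
  finally show "emeasure unif {Y. prefix Y n = w} = ennreal ((1/2) ^ n)" .
qed

lemma emeasure_unif_prefix:
  assumes "S \<subseteq> {w. length w = n}"
  shows "{Y. prefix Y n \<in> S} \<in> sets unif"
    and "emeasure unif {Y. prefix Y n \<in> S} = ennreal (real (card S) / 2 ^ n)"
proof -
  have fin: "finite S"
    using finite_subset[OF assms] finite_length_eq[of "\<lambda>_. True" n] by simp
  have eq: "{Y. prefix Y n \<in> S} = (\<Union>w\<in>S. {Y. prefix Y n = w})" by auto
  have meas: "{Y. prefix Y n = w} \<in> sets unif" if "w \<in> S" for w
    using assms that by (intro cylinder_unif(1)) auto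
  then show "{Y. prefix Y n \<in> S} \<in> sets unif"
    unfolding eq using fin by (intro sets.finite_UN)
  have "emeasure unif {Y. prefix Y n \<in> S} = (\<Sum>w\<in>S. emeasure unif {Y. prefix Y n = w})"
    unfolding eq using meas fin by (intro sum_emeasure[symmetric]) (auto simp: disjoint_family_on_def)
  also have "\<dots> = (\<Sum>w\<in>S. ennreal ((1/2) ^ n))"
    using assms by (intro sum.cong cylinder_unif(2)) auto
  also have "\<dots> = ennreal (real (card S) / 2 ^ n)"
    by (simp add: ennreal_of_nat_eq_real_of_nat power_divide flip: ennreal_mult)
  finally show "emeasure unif {Y. prefix Y n \<in> S} = ennreal (real (card S) / 2 ^ n)" .
qed

definition yes_count :: "(bool list \<Rightarrow> bool) \<Rightarrow> bool list \<Rightarrow> nat" where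
  "yes_count l w = card {i. i \<le> length w \<and> l (take i w)}"

lemma AVG_eq: "AVG l w = real (yes_count l w) / real (length w)"
proof -
  have "{0..length w} \<inter> {i. l (take i w)} = {i. i \<le> length w \<and> l (take i w)}" by auto
  then show ?thesis by (simp add: AVG_def yes_count_def)
qed

lemma yes_count_prefix: "yes_count l (prefix Y n) = card {i. i \<le> n \<and> l (prefix Y i)}"
  by (simp add: yes_count_def take_prefix cong: conj_cong)

text \<open>Any n yes answers already occur along a finite prefix, so the event is an increasing
  union of events decided at length N. The infinite case is listed separately because
  \<open>card\<close> of an infinite set is 0.\<close>

lemma yes_event_eq:
  "{Y. infinite {i. l (prefix Y i)} \<or> n \<le> card {i. l (prefix Y i)}} =
    (\<Union>N. {Y. prefix Y N \<in> {w. length w = N \<and> n \<le> yes_count l w}})"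
proof (intro equalityI subsetI)
  fix Y assume Y: "Y \<in> {Y. infinite {i. l (prefix Y i)} \<or> n \<le> card {i. l (prefix Y i)}}"
  then obtain F where F: "F \<subseteq> {i. l (prefix Y i)}" "card F = n" "finite F"
  proof (cases "finite {i. l (prefix Y i)}")
    case True
    then obtain F where "F \<subseteq> {i. l (prefix Y i)}" "card F = n"
      using Y obtain_subset_with_card_n[of n "{i. l (prefix Y i)}"] by auto
    then show thesis using True finite_subset[of F] by (intro that[of F]) auto
  next
    case False
    then show thesis using infinite_arbitrarily_large[OF False, of n] that by blast
  qed
  define N where "N = Max (insert 0 F)"
  have "F \<subseteq> {i. i \<le> N \<and> l (prefix Y i)}" using F by (auto simp: N_def)
  then have "n \<le> yes_count l (prefix Y N)"
    unfolding yes_count_prefix using F(2) by (metis card_mono finite_Collect_conjI finite_Collect_le_nat)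
  then show "Y \<in> (\<Union>N. {Y. prefix Y N \<in> {w. length w = N \<and> n \<le> yes_count l w}})" by auto
next
  fix Y assume "Y \<in> (\<Union>N. {Y. prefix Y N \<in> {w. length w = N \<and> n \<le> yes_count l w}})"
  then obtain N where "n \<le> card {i. i \<le> N \<and> l (prefix Y i)}" by (auto simp: yes_count_prefix)
  moreover have "card {i. i \<le> N \<and> l (prefix Y i)} \<le> card {i. l (prefix Y i)}"
    if "finite {i. l (prefix Y i)}" using that by (intro card_mono) auto
  ultimately show "Y \<in> {Y. infinite {i. l (prefix Y i)} \<or> n \<le> card {i. l (prefix Y i)}}" by auto
qed

text \<open>By continuity from below the measure condition on learners becomes a count of strings at
  each length. From here on measure enters only through this equivalence.\<close>

lemma yes_event_measure_le_iff:
  "emeasure unif {Y. infinite {i. l (prefix Y i)} \<or> n \<le> card {i. l (prefix Y i)}}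
      \<le> ennreal (2 powr (- real n)) \<longleftrightarrow>
    (\<forall>N. real (card {w. length w = N \<and> n \<le> yes_count l w}) * 2 ^ n \<le> 2 ^ N)"
proof -
  define E where "E = (\<lambda>N. {Y. prefix Y N \<in> {w. length w = N \<and> n \<le> yes_count l w}})"
  have meas: "E N \<in> sets unif"
    and E: "emeasure unif (E N) = ennreal (real (card {w. length w = N \<and> n \<le> yes_count l w}) / 2 ^ N)" for N
    unfolding E_def using emeasure_unif_prefix[of "{w. length w = N \<and> n \<le> yes_count l w}" N] by auto
  have "incseq E"
    unfolding E_def
    by (intro incseq_SucI) (auto simp: yes_count_prefix intro!: card_mono elim!: order_trans)
  then have "emeasure unif (\<Union>N. E N) = (SUP N. emeasure unif (E N))"
    using meas by (intro SUP_emeasure_incseq[symmetric]) auto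
  then have "emeasure unif (\<Union>N. E N) \<le> ennreal (2 powr (- real n)) \<longleftrightarrow>
      (\<forall>N. emeasure unif (E N) \<le> ennreal (2 powr (- real n)))"
    by (simp add: SUP_le_iff)
  also have "\<dots> \<longleftrightarrow> (\<forall>N. real (card {w. length w = N \<and> n \<le> yes_count l w}) * 2 ^ n \<le> 2 ^ N)"
    unfolding E by (simp add: powr_minus powr_realpow field_simps)
  finally show ?thesis unfolding yes_event_eq E_def .
qed

section \<open>Ville's inequality as a statement about counting\<close>

lemma card_length_eq: "card {w :: bool list. length w = n} = 2 ^ n"
  using card_lists_length_eq[of "UNIV :: bool set" n] by simp

text \<open>The induction splits off the first bit, which is why m is arbitrary: the two subtrees
  carry the martingales \<open>m (False # w)\<close> and \<open>m (True # w)\<close>, whose initial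
  values add up to \<open>2 * m []\<close>. If the root already exceeds c, counting all strings is
  good enough.\<close>

lemma card_martingale_exceeds:
  fixes m :: "bool list \<Rightarrow> real"
  assumes "c > 0" "\<And>w. m w \<ge> 0" "\<And>w. m (w @ [False]) + m (w @ [True]) = 2 * m w"
  shows "real (card {w. length w = N \<and> (\<exists>j\<le>N. m (take j w) > c)}) * c \<le> 2 ^ N * m []"
  using assms(2,3)
proof (induction N arbitrary: m)
  case 0
  show ?case
  proof (cases "m [] > c")
    case True
    then have "{w. length w = 0 \<and> (\<exists>j\<le>0. m (take j w) > c)} = {[]}" by auto
    then show ?thesis using True by simp
  qed (use 0 in auto)
next
  case (Suc N)
  show ?case
  proof (cases "m [] > c")
    case True
    have "card {w. length w = Suc N \<and> (\<exists>j\<le>Suc N. m (take j w) > c)} \<le> 2 ^ Suc N"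
      unfolding card_length_eq[symmetric] using finite_length_eq[of "\<lambda>_. True"]
      by (intro card_mono) auto
    then have "real (card {w. length w = Suc N \<and> (\<exists>j\<le>Suc N. m (take j w) > c)}) \<le> 2 ^ Suc N"
      by (simp only: of_nat_le_iff[where 'a = real, symmetric] of_nat_power of_nat_numeral)
    then show ?thesis using True assms(1) by (intro mult_mono) auto
  next
    case False
    define S where "S = (\<lambda>b. {w. length w = N \<and> (\<exists>j\<le>N. m (b # take j w) > c)})"
    have "{w. length w = Suc N \<and> (\<exists>j\<le>Suc N. m (take j w) > c)} \<subseteq>
        Cons False ` S False \<union> Cons True ` S True"
    proof
      fix w assume "w \<in> {w. length w = Suc N \<and> (\<exists>j\<le>Suc N. m (take j w) > c)}"
      then obtain j where w: "length w = Suc N" "j \<le> Suc N" "m (take j w) > c" by auto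
      obtain b w' where w': "w = b # w'" using w(1) by (cases w) auto
      obtain i where "j = Suc i" using w(3) False by (cases j) auto
      then have "w' \<in> S b" using w w' by (auto simp: S_def)
      then show "w \<in> Cons False ` S False \<union> Cons True ` S True" using w' by (cases b) auto
    qed
    moreover have fin: "finite (S b)" for b
      unfolding S_def by (rule finite_subset[OF _ finite_length_eq[of "\<lambda>_. True" N]]) auto
    ultimately have "card {w. length w = Suc N \<and> (\<exists>j\<le>Suc N. m (take j w) > c)} \<le>
        card (Cons False ` S False) + card (Cons True ` S True)"
      by (intro order_trans[OF card_mono card_Un_le]) auto
    also have "\<dots> \<le> card (S False) + card (S True)"
      by (intro add_mono card_image_le fin)
    finally have "real (card {w. length w = Suc N \<and> (\<exists>j\<le>Suc N. m (take j w) > c)}) * c \<le>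
        real (card (S False) + card (S True)) * c"
      using assms(1) by (intro mult_right_mono of_nat_mono) auto
    also have "\<dots> = real (card (S False)) * c + real (card (S True)) * c"
      by (simp add: algebra_simps)
    also have "\<dots> \<le> 2 ^ N * m [False] + 2 ^ N * m [True]"
      unfolding S_def
      using Suc.IH[of "\<lambda>w. m (False # w)"] Suc.IH[of "\<lambda>w. m (True # w)"] Suc.prems
      by (intro add_mono) (simp_all flip: append_Cons)
    also have "\<dots> = 2 ^ Suc N * m []"
      using Suc.prems(2)[of "[]"] by (simp flip: distrib_left)
    finally show ?thesis .
  qed
qed

section \<open>Limits superior as statements about infinitely many prefixes\<close>

lemma limsup_ge_of_frequently:
  fixes f :: "nat \<Rightarrow> real"
  assumes "\<exists>\<^sub>F n in sequentially. c \<le> f n"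
  shows "ereal c \<le> limsup (\<lambda>n. ereal (f n))"
proof (rule ccontr)
  assume "\<not> ereal c \<le> limsup (\<lambda>n. ereal (f n))"
  then have "\<forall>\<^sub>F n in sequentially. ereal (f n) < ereal c"
    by (intro Limsup_lessD) simp
  then show False using assms by (simp add: frequently_def not_le)
qed

lemma frequently_of_less_limsup:
  fixes f :: "nat \<Rightarrow> real"
  assumes "ereal c < limsup (\<lambda>n. ereal (f n))"
  shows "\<exists>\<^sub>F n in sequentially. c < f n"
proof (rule ccontr)
  assume "\<not> (\<exists>\<^sub>F n in sequentially. c < f n)"
  then have "limsup (\<lambda>n. ereal (f n)) \<le> ereal c"
    by (intro Limsup_bounded) (simp add: not_frequently not_less)
  then show False using assms by simp
qed

lemma succeeds_iff: "succeeds d X \<longleftrightarrow> (\<forall>c. \<exists>\<^sub>F n in sequentially. c < d (prefix X n))"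
proof
  assume "succeeds d X"
  then show "\<forall>c. \<exists>\<^sub>F n in sequentially. c < d (prefix X n)"
    unfolding succeeds_def by (auto intro: frequently_of_less_limsup)
next
  assume freq: "\<forall>c. \<exists>\<^sub>F n in sequentially. c < d (prefix X n)"
  have "ereal c \<le> limsup (\<lambda>n. ereal (d (prefix X n)))" for c
    by (intro limsup_ge_of_frequently frequently_elim1[OF freq[rule_format, of c]]) simp
  then show "succeeds d X"
    unfolding succeeds_def by (metis ereal_top)
qed

lemma martingale_of_gale:
  assumes "is_gale t d" "c > 0"
  shows "is_gale 1 (\<lambda>w. d w * (2 / 2 powr t) ^ length w / c)"
  unfolding is_gale_iff
proof (intro conjI allI)
  fix w
  show "0 \<le> d w * (2 / 2 powr t) ^ length w / c"
    using assms by (simp add: is_gale_iff)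
  have "d (w @ [False]) * (2 / 2 powr t) ^ length (w @ [False]) / c +
      d (w @ [True]) * (2 / 2 powr t) ^ length (w @ [True]) / c =
      (d (w @ [False]) + d (w @ [True])) * (2 / 2 powr t) ^ Suc (length w) / c"
    by (simp add: add_divide_distrib distrib_right)
  also have "\<dots> = 2 powr 1 * (d w * (2 / 2 powr t) ^ length w / c)"
    using assms by (simp add: is_gale_iff)
  finally show "d (w @ [False]) * (2 / 2 powr t) ^ length (w @ [False]) / c +
      d (w @ [True]) * (2 / 2 powr t) ^ length (w @ [True]) / c =
      2 powr 1 * (d w * (2 / 2 powr t) ^ length w / c)" .
qed

text \<open>At length n, \<open>d w > 1\<close> says that the associated martingale exceeds
  \<open>(2 / \<rho>) ^ n\<close>, so the counting inequality leaves at most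
  \<open>d [] * \<rho> ^ n\<close> strings.\<close>

lemma card_gale_exceeds:
  assumes "is_gale s d"
  shows "real (card {w \<in> {w. d w > 1}. length w = n}) \<le> d [] * 2 powr (s * real n)"
proof -
  define \<rho> where "\<rho> = 2 powr s"
  have "\<rho> > 0" by (simp add: \<rho>_def)
  define m where "m = (\<lambda>w. d w * (2 / \<rho>) ^ length w / 1)"
  have gale: "is_gale 1 m"
    unfolding m_def \<rho>_def using assms by (rule martingale_of_gale) simp
  have "real (card {w \<in> {w. d w > 1}. length w = n}) \<le>
      real (card {w. length w = n \<and> (\<exists>j\<le>n. m (take j w) > (2 / \<rho>) ^ n)})"
  proof (intro of_nat_mono card_mono)
    show "finite {w :: bool list. length w = n \<and> (\<exists>j\<le>n. m (take j w) > (2 / \<rho>) ^ n)}"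
      by (rule finite_subset[OF _ finite_length_eq[of "\<lambda>_. True" n]]) auto
    show "{w \<in> {w. d w > 1}. length w = n} \<subseteq> {w. length w = n \<and> (\<exists>j\<le>n. m (take j w) > (2 / \<rho>) ^ n)}"
      using \<open>\<rho> > 0\<close> by (auto intro!: exI[of _ n] simp: m_def)
  qed
  moreover have "real (card {w. length w = n \<and> (\<exists>j\<le>n. m (take j w) > (2 / \<rho>) ^ n)}) * (2 / \<rho>) ^ n
      \<le> 2 ^ n * m []"
    using gale \<open>\<rho> > 0\<close> unfolding is_gale_iff by (intro card_martingale_exceeds) auto
  ultimately have "real (card {w \<in> {w. d w > 1}. length w = n}) * (2 / \<rho>) ^ n \<le> 2 ^ n * d []"
    using \<open>\<rho> > 0\<close> by (auto simp: m_def elim!: order_trans[rotated] intro!: mult_right_mono)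
  then have "real (card {w \<in> {w. d w > 1}. length w = n}) \<le> d [] * \<rho> ^ n"
    using \<open>\<rho> > 0\<close> by (simp add: power_divide field_simps)
  then show ?thesis by (simp add: \<rho>_def powr_realpow[symmetric] powr_powr)
qed

text \<open>The learner answers yes exactly when the running maximum of a normalised martingale passes a
  new power of two. A martingale at most doubles in one step, so passing one power at a time
  suffices, and condition (2) is Ville's inequality,
  used in the finite form \<open>card_martingale_exceeds\<close>.\<close>

lemma learner_of_gale:
  assumes d: "lower_semicomputable d" "is_gale t d"
    and ab: "a > 0" "b > 0" "2 powr t = real a / real b"
  obtains l where "\<And>X. succeeds d X \<Longrightarrow> alg_learns t l X"
proof -
  obtain p q g where pq:
    "computable 2 (\<lambda>xs. p (xs ! 0) (xs ! 1))" "computable 2 (\<lambda>xs. q (xs ! 0) (xs ! 1))"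
    and g: "\<And>w u. g w u = real (p (bits_code w) u) / real (q (bits_code w) u + 1)"
    "\<And>w u. g w u \<le> g w (Suc u)" "\<And>w u. g w u \<le> d w" "\<And>w. (\<lambda>u. g w u) \<longlonglongrightarrow> d w"
    by (rule lower_semicomputableE[OF d(1)]) (rule that)
  \<comment> \<open>A natural upper bound for the initial capital, so that dividing by it preserves
    exact arithmetic and gives \<open>m [] \<le> 1\<close>. The successor makes it positive even if
    \<open>d []\<close> is 0.\<close>
  define c where "c = Suc (nat \<lceil>d []\<rceil>)"
  have c: "c > 0" "d [] \<le> real c" unfolding c_def by linarith+
  define \<rho> where "\<rho> = real a / real b"
  have rho: "\<rho> > 0" using ab by (simp add: \<rho>_def)
  define m where "m = (\<lambda>w. d w * (2 / \<rho>) ^ length w / real c)"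
  define G where "G = (\<lambda>w u. g w u * (2 / \<rho>) ^ length w / real c)"
  have gale: "is_gale 1 m"
    unfolding m_def \<rho>_def ab(3)[symmetric] using d(2) c by (intro martingale_of_gale) auto
  then have m: "m w \<ge> 0" "m (w @ [False]) + m (w @ [True]) = 2 * m w" for w
    unfolding is_gale_iff by simp_all
  have m_snoc: "m (w @ [b]) \<le> 2 * m w" for w b
    using m(1)[of "w @ [False]"] m(1)[of "w @ [True]"] m(2)[of w] by (cases b) auto
  have m_Nil: "m [] \<le> 1" using c by (simp add: m_def)
  have m_le: "m w \<le> 2 ^ length w" for w
  proof -
    have "m w \<le> 2 ^ length w * m []" using gale_le_power[OF gale, of w] by simp
    also have "\<dots> \<le> 2 ^ length w" using m_Nil by (intro mult_left_le) auto
    finally show ?thesis .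
  qed
  \<comment> \<open>The thresholds start at 2, not at 1: then k hits force a value above
    \<open>2 ^ k\<close>, which yields exactly the bound \<open>2 powr (- k)\<close> demanded of a
    learner.\<close>
  define hit where "hit = (\<lambda>w k. \<exists>j\<le>length w. m (take j w) > 2 ^ Suc k)"
  have hit_less: "k < length w" if hit: "hit w k" for w k
  proof -
    obtain j where j: "j \<le> length w" "m (take j w) > 2 ^ Suc k" using hit by (auto simp: hit_def)
    have "m (take j w) \<le> 2 ^ j" using m_le[of "take j w"] j(1) by simp
    with j(2) have "(2::real) ^ Suc k < 2 ^ j" by (rule order.strict_trans2)
    then have "Suc k < j" by (rule power_less_imp_less_exp[rotated]) simp
    then show ?thesis using j(1) by simp
  qed
  have fin: "finite (Collect (hit w))" for w
    by (rule finite_subset[of _ "{..<length w}"]) (auto dest: hit_less)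
  define cnt where "cnt = (\<lambda>w. card (Collect (hit w)))"
  \<comment> \<open>Since m is at most \<open>2 ^ length w\<close>, only levels below the length can
    be hit. The count is therefore a bounded sum of bounded searches, which can be approximated
    effectively.\<close>
  have cnt_sum: "cnt w = (\<Sum>k<length w. of_bool (\<exists>j<Suc (length w). m (take j w) > 2 ^ Suc k))" for w
  proof -
    have "{..<length w} \<inter> {k. \<exists>j<Suc (length w). m (take j w) > 2 ^ Suc k} = Collect (hit w)"
      using hit_less by (auto simp: hit_def less_Suc_eq_le)
    then show ?thesis by (simp add: cnt_def)
  qed
  have cnt_snoc: "cnt w \<le> cnt (w @ [b])" "cnt (w @ [b]) \<le> Suc (cnt w)" for w b
  proof -
    have "hit (w @ [b]) k" if k: "hit w k" for k
    proof -
      obtain j where "j \<le> length w" "m (take j w) > 2 ^ Suc k" using k by (auto simp: hit_def)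
      then show ?thesis unfolding hit_def by (intro exI[of _ j]) auto
    qed
    then show "cnt w \<le> cnt (w @ [b])"
      unfolding cnt_def by (intro card_mono fin) auto
    have step: "hit w k" if k: "hit (w @ [b]) (Suc k)" for k
    proof -
      obtain j where j: "j \<le> Suc (length w)" "m (take j (w @ [b])) > 2 ^ Suc (Suc k)"
        using k by (auto simp: hit_def)
      show ?thesis
      proof (cases "j \<le> length w")
        case True
        have "(2::real) ^ Suc k < 2 ^ Suc (Suc k)" by simp
        also have "\<dots> < m (take j w)" using j(2) True by simp
        finally show ?thesis using True unfolding hit_def by blast
      next
        case False
        then have "take j (w @ [b]) = w @ [b]" using j(1) by simp
        then have "m w > 2 ^ Suc k" using j(2) m_snoc[of w b] by simp
        then show ?thesis unfolding hit_def by (intro exI[of _ "length w"]) simp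
      qed
    qed
    have "Collect (hit (w @ [b])) \<subseteq> insert 0 (Suc ` Collect (hit w))"
    proof
      fix k assume "k \<in> Collect (hit (w @ [b]))"
      then show "k \<in> insert 0 (Suc ` Collect (hit w))" using step by (cases k) auto
    qed
    then have "cnt (w @ [b]) \<le> card (insert 0 (Suc ` Collect (hit w)))"
      unfolding cnt_def by (intro card_mono) (auto intro: fin)
    also have "\<dots> \<le> Suc (cnt w)"
      unfolding cnt_def using card_image_le[OF fin, of Suc w] fin by (simp add: card_insert_if)
    finally show "cnt (w @ [b]) \<le> Suc (cnt w)" .
  qed
  \<comment> \<open>No effectivity of \<open>l\<close> itself is claimed: it compares two limits.
    Condition (1) speaks only of the average, in which these increments telescope to
    \<open>cnt\<close>.\<close>
  define l where "l = (\<lambda>w. w \<noteq> [] \<and> cnt w \<noteq> cnt (butlast w))"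
  have yes: "yes_count l w = cnt w" for w
  proof (induction w rule: rev_induct)
    case Nil
    have "cnt [] = 0" unfolding cnt_sum by simp
    then show ?case by (simp add: yes_count_def l_def)
  next
    case (snoc b w)
    have "{i. i \<le> length (w @ [b]) \<and> l (take i (w @ [b]))} =
       {i. i \<le> length w \<and> l (take i w)} \<union> (if l (w @ [b]) then {Suc (length w)} else {})"
      by (auto simp: le_Suc_eq)
    then have "yes_count l (w @ [b]) = yes_count l w + of_bool (l (w @ [b]))"
      unfolding yes_count_def by auto
    then show ?case using snoc cnt_snoc[of w b] by (auto simp: l_def)
  qed
  have hits: "\<exists>j\<le>length w. m (take j w) > 2 ^ k" if k: "k \<le> cnt w" "k > 0" for w k
  proof -
    \<comment> \<open>Pigeonhole: k distinct levels cannot all lie below k - 1, so some hit level is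
      at least k - 1.\<close>
    have "\<not> Collect (hit w) \<subseteq> {..<k - 1}"
      using card_mono[of "{..<k - 1}" "Collect (hit w)"] k by (auto simp: cnt_def)
    then obtain i where "hit w i" "k \<le> Suc i" by (auto simp: subset_iff not_less)
    moreover have "(2::real) ^ k \<le> 2 ^ Suc i" if "k \<le> Suc i" for i
      using that by (intro power_increasing) auto
    ultimately show ?thesis unfolding hit_def by (blast intro: order.strict_trans1)
  qed
  have measure: "real (card {w. length w = N \<and> k \<le> yes_count l w}) * 2 ^ k \<le> 2 ^ N" for N k
  proof (cases "k = 0")
    case False
    have "card {w. length w = N \<and> k \<le> yes_count l w} \<le>
        card {w. length w = N \<and> (\<exists>j\<le>N. m (take j w) > 2 ^ k)}"
      using hits False by (intro card_mono finite_subset[OF _ finite_length_eq[of "\<lambda>_. True" N]])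
        (auto simp: yes)
    then have "real (card {w. length w = N \<and> k \<le> yes_count l w}) * 2 ^ k \<le>
        real (card {w. length w = N \<and> (\<exists>j\<le>N. m (take j w) > 2 ^ k)}) * 2 ^ k"
      by (intro mult_right_mono of_nat_mono) auto
    also have "\<dots> \<le> 2 ^ N * m []" using m by (intro card_martingale_exceeds) auto
    also have "\<dots> \<le> 2 ^ N" using m_Nil by (intro mult_left_le) auto
    finally show ?thesis .
  qed (simp add: card_length_eq)
  have lsc: "lower_semicomputable (AVG l)"
  proof -
    \<comment> \<open>The inner inequality is \<open>G (take j w) u > 2 ^ Suc k\<close> with all
      denominators cleared, so that only naturals are compared.\<close>
    define P where "P = (\<lambda>n u. \<Sum>k<code_length n. of_bool (\<exists>j<Suc (code_length n).
      2 ^ Suc k * a ^ j * c * (q (code_take j n) u + 1) < p (code_take j n) u * (2 * b) ^ j) :: nat)"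
    define Q where "Q = (\<lambda>n (u :: nat). code_length n - 1)"
    define H where "H = (\<lambda>w u k. \<exists>j<Suc (length w). G (take j w) u > 2 ^ Suc k)"
    have P: "P (bits_code w) u = (\<Sum>k<length w. of_bool (H w u k))" for w u
    proof -
      have "2 ^ Suc k * a ^ j * c * (q (code_take j (bits_code w)) u + 1) <
          p (code_take j (bits_code w)) u * (2 * b) ^ j \<longleftrightarrow> G (take j w) u > 2 ^ Suc k"
        if j: "j < Suc (length w)" for j k
      proof -
        define n where "n = bits_code (take j w)"
        have n: "code_take j (bits_code w) = n" using j by (simp add: n_def code_take_bits_code)
        have "2 ^ Suc k * a ^ j * c * (q n u + 1) < p n u * (2 * b) ^ j \<longleftrightarrow>
            2 ^ Suc k * real a ^ j * real c * real (q n u + 1) < real (p n u) * (2 * real b) ^ j"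
          by (simp only: of_nat_less_iff[where 'a = real, symmetric] of_nat_mult of_nat_power of_nat_numeral)
        also have "\<dots> \<longleftrightarrow> 2 ^ Suc k < real (p n u) * (2 * real b) ^ j / (real a ^ j * real c * real (q n u + 1))"
          using ab(1) c(1) by (subst pos_less_divide_eq) (auto simp: mult_ac)
        also have "real (p n u) * (2 * real b) ^ j / (real a ^ j * real c * real (q n u + 1)) = G (take j w) u"
          using j by (simp add: G_def g(1) n_def \<rho>_def power_divide power_mult_distrib)
        finally show ?thesis unfolding n .
      qed
      then show ?thesis unfolding P_def H_def code_length_bits_code
        by (intro sum.cong refl arg_cong[where f = of_bool]) blast
    qed
    have G_mono: "G w u \<le> G w (Suc u)" for w u
      unfolding G_def using g(2) rho by (intro divide_right_mono mult_right_mono) auto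
    have G_le: "G w u \<le> m w" for w u
      unfolding G_def m_def using g(3) rho by (intro divide_right_mono mult_right_mono) auto
    have G_lim: "(\<lambda>u. G w u) \<longlonglongrightarrow> m w" for w
      unfolding G_def m_def using c(1) by (intro tendsto_intros g(4)) auto
    have H_Suc: "H w u k \<Longrightarrow> H w (Suc u) k" for w u k
      unfolding H_def using G_mono by (blast intro: order.strict_trans2)
    have "AVG l = (\<lambda>w. real (cnt w) / real (length w))" by (simp add: fun_eq_iff AVG_eq yes)
    moreover have "lower_semicomputable (\<lambda>w. real (cnt w) / real (length w))"
    proof (rule lower_semicomputableI[where p = P and q = Q and
          g = "\<lambda>w u. real (P (bits_code w) u) / real (length w)"])
      show "computable 2 (\<lambda>xs. P (xs ! 0) (xs ! 1))" unfolding P_def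
        by (intro computable_intros computable_app_curried[OF pq(1)] computable_app_curried[OF pq(2)]
            computable_code_take computable_code_length) simp_all
      show "computable 2 (\<lambda>xs. Q (xs ! 0) (xs ! 1))" unfolding Q_def
        by (intro computable_intros computable_code_length) simp_all
      fix w :: "bool list"
      show "real (P (bits_code w) u) / real (length w) =
          real (P (bits_code w) u) / real (Q (bits_code w) u + 1)" for u
      \<comment> \<open>At the empty string the average is a division by zero, hence 0, while the
        computed denominator is 1. The two agree because the count there is 0.\<close>
      proof (cases "w = []")
        case True
        then show ?thesis using P[of w u] by simp
      next
        case False
        then have "Q (bits_code w) u + 1 = length w" by (simp add: Q_def)
        then show ?thesis by simp
      qed
      show "real (P (bits_code w) u) / real (length w) \<le> real (P (bits_code w) (Suc u)) / real (length w)" for u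
        unfolding P by (intro divide_right_mono of_nat_mono sum_mono) (use H_Suc in auto)
      \<comment> \<open>Each indicator is eventually constant: a strict excess of the limit shows at
        a finite stage, and \<open>G \<le> m\<close> rules out false hits.\<close>
      have "(\<lambda>u. of_bool (H w u k) :: real) \<longlonglongrightarrow> of_bool (\<exists>j<Suc (length w). m (take j w) > 2 ^ Suc k)" for k
      proof (cases "\<exists>j<Suc (length w). m (take j w) > 2 ^ Suc k")
        case True
        then obtain j where j: "j < Suc (length w)" "m (take j w) > 2 ^ Suc k" by blast
        have "\<forall>\<^sub>F u in sequentially. H w u k"
          using order_tendstoD(1)[OF G_lim j(2)] by eventually_elim (use j(1) in \<open>auto simp: H_def\<close>)
        then show ?thesis using True by (intro tendsto_eventually) (auto elim: eventually_mono)
      next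
        case False
        then have "\<not> H w u k" for u
          unfolding H_def using G_le by (blast intro: order.strict_trans2)
        then show ?thesis by (simp only: False of_bool_eq tendsto_const)
      qed
      then have "(\<lambda>u. \<Sum>k<length w. of_bool (H w u k) :: real) \<longlonglongrightarrow>
          (\<Sum>k<length w. of_bool (\<exists>j<Suc (length w). m (take j w) > 2 ^ Suc k))"
        by (rule tendsto_sum)
      then have "(\<lambda>u. real (P (bits_code w) u)) \<longlonglongrightarrow> real (cnt w)"
        unfolding P cnt_sum of_nat_sum of_nat_of_bool .
      then show "(\<lambda>u. real (P (bits_code w) u) / real (length w)) \<longlonglongrightarrow> real (cnt w) / real (length w)"
        unfolding divide_inverse by (rule tendsto_mult_right)
    qed
    ultimately show ?thesis by simp
  qed
  have "alg_learns t l X" if X: "succeeds d X" for X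
    unfolding alg_learns_def yes_event_measure_le_iff
  proof (intro conjI allI lsc measure)
    \<comment> \<open>Rounding the exponent down to an integer loses at most one yes answer, that is
      1/n in the average. This is absorbed by any r below 1 - t, and \<open>dense_le\<close> then
      reaches 1 - t itself.\<close>
    have "ereal r \<le> limsup (\<lambda>n. ereal (AVG l (prefix X n)))" if r: "r < 1 - t" for r
    proof (rule limsup_ge_of_frequently)
      have "\<exists>\<^sub>F n in sequentially. real c < d (prefix X n)"
        using X by (simp add: succeeds_iff)
      moreover have "\<forall>\<^sub>F n in sequentially. n > 0 \<and> 1 < real n * (1 - t - r)"
        using r by (intro eventually_conj) real_asymp+
      ultimately show "\<exists>\<^sub>F n in sequentially. r \<le> AVG l (prefix X n)"
      proof (rule frequently_elim1[OF frequently_eventually_conj])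
        fix n assume n: "(n > 0 \<and> 1 < real n * (1 - t - r)) \<and> real c < d (prefix X n)"
        \<comment> \<open>Capital above c at length n means \<open>m > 2 powr ((1 - t) * n)\<close>;
          k is the largest natural power of two guaranteed by this, and 0 when the exponent is
          negative.\<close>
        define k where "k = nat \<lfloor>(1 - t) * real n\<rfloor>"
        have "k \<le> cnt (prefix X n)"
        proof (cases "k = 0")
          case False
          then have "real k \<le> (1 - t) * real n" unfolding k_def by linarith
          then have "2 ^ k \<le> 2 powr ((1 - t) * real n)"
            by (simp flip: powr_realpow)
          also have "\<dots> = (2 / \<rho>) ^ n"
          proof -
            have "2 / \<rho> = 2 powr (1 - t)" by (simp add: powr_diff \<rho>_def ab(3))
            then show ?thesis by (simp add: powr_realpow[symmetric] powr_powr)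
          qed
          also have "\<dots> < m (prefix X n)"
            using n c(1) rho by (simp add: m_def pos_less_divide_eq mult.commute)
          finally have k: "2 ^ k < m (prefix X n)" .
          have "hit (prefix X n) i" if "i < k" for i
          proof -
            have "(2::real) ^ Suc i \<le> 2 ^ k" using that by (intro power_increasing) auto
            then show ?thesis using k unfolding hit_def by (intro exI[of _ n]) simp
          qed
          then have "card {..<k} \<le> cnt (prefix X n)"
            unfolding cnt_def by (intro card_mono fin) auto
          then show ?thesis by simp
        qed simp
        moreover have "(1 - t) * real n - 1 \<le> real k" unfolding k_def by linarith
        ultimately have "real n * r \<le> real (cnt (prefix X n))"
          using n by (simp add: algebra_simps)
        then show "r \<le> AVG l (prefix X n)"
          using n by (simp add: AVG_eq yes pos_le_divide_eq mult.commute)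
      qed
    qed
    then have "x \<le> limsup (\<lambda>n. ereal (AVG l (prefix X n)))" if "x < ereal (1 - t)" for x
      using that by (cases x) auto
    then show "limsup (\<lambda>n. ereal (AVG l (prefix X n))) \<ge> ereal (1 - t)"
      by (rule dense_le)
  qed
  then show thesis by (rule that)
qed

section \<open>Sparse sets from learners\<close>

lemma rational_between:
  fixes x y :: real
  assumes "0 \<le> x" "x < y"
  obtains a b :: nat where "a > 0" "b > 0" "x < real a / real b" "real a / real b < y"
proof -
  obtain z where z: "z \<in> \<rat>" "x < z" "z < y" using Rats_dense_in_real[OF assms(2)] by auto
  obtain a b where "b \<noteq> 0" "\<bar>z\<bar> = real a / real b" using z(1) by (rule Rats_abs_nat_div_natE)
  then show thesis using that[of a b] z assms(1) by (cases "a = 0") auto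
qed

text \<open>Spikes and rescaled martingales involve \<open>2 powr u\<close> rather than u, so this
  power is what is made rational, as the pullback of a fraction between \<open>2 powr s\<close> and
  \<open>2 powr t\<close>.\<close>

lemma log_rational_between:
  fixes s t :: real
  assumes "s < t"
  obtains u and a b :: nat where "s < u" "u < t" "a > 0" "b > 0" "2 powr u = real a / real b"
proof -
  obtain a b :: nat where ab: "a > 0" "b > 0" "2 powr s < real a / real b" "real a / real b < 2 powr t"
    using rational_between[of "2 powr s" "2 powr t"] assms by auto
  define u where "u = log 2 (real a / real b)"
  have u: "2 powr u = real a / real b" using ab by (simp add: u_def)
  then have "2 powr s < 2 powr u" "2 powr u < 2 powr t" using ab by simp_all
  then have "s < u" "u < t" by simp_all
  then show thesis using that[of u a b] ab u by simp
qed

lemma enumerable_const: "enumerable {w. P}"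
  unfolding enumerable_def
  by (intro exI[of _ "\<lambda>_ _. P"]) (auto simp: decidable_def intro: computable_const)

lemma sparse_set_of_learner:
  assumes l: "\<And>X. X \<in> \<Gamma> \<Longrightarrow> alg_learns s l X" and st: "0 \<le> s" "s < t"
  obtains A s' C where "s' < t" "enumerable A"
    "\<And>n. real (card {w \<in> A. length w = n}) \<le> C * 2 powr (s' * real n)"
    "\<And>X. X \<in> \<Gamma> \<Longrightarrow> \<exists>\<^sub>F n in sequentially. prefix X n \<in> A"
proof -
  \<comment> \<open>Conditions (1) and (2) on \<open>l\<close> are available only through some
    member of \<open>\<Gamma>\<close>, so the empty class is treated apart. For s at least 1
    condition (3) gives no positive threshold, but then 1 < t and the set of all strings is sparse
    enough.\<close>
  consider (empty) "\<Gamma> = {}" | (large) "1 \<le> s" | (small) X0 where "X0 \<in> \<Gamma>" "s < 1"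
    by fastforce
  then show thesis
  proof cases
    case empty
    show thesis
      by (rule that[OF st(2) enumerable_const[of False], of 0]) (use empty in auto)
  next
    case large
    show thesis
      by (rule that[of 1 "{w. True}" 1, OF _ enumerable_const])
         (use large st in \<open>auto simp: card_length_eq powr_realpow\<close>)
  next
    case small
    \<comment> \<open>The threshold r lies below 1 - s to be exceeded infinitely often, above 1 - t
      to make the growth rate 1 - r smaller than t, and above 0 to be a fraction of
      naturals.\<close>
    have "max 0 (1 - t) < 1 - s" using small(2) st by simp
    then obtain a b :: nat where ab: "a > 0" "b > 0" "max 0 (1 - t) < real a / real b"
        "real a / real b < 1 - s"
      using rational_between[of "max 0 (1 - t)" "1 - s"] by auto
    define r where "r = real a / real b"
    define A where "A = {w. AVG l w > r}"
    have lsc: "lower_semicomputable (AVG l)"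
      and meas: "\<And>n N. real (card {w. length w = N \<and> n \<le> yes_count l w}) * 2 ^ n \<le> 2 ^ N"
      using l[OF small(1)] unfolding alg_learns_def yes_event_measure_le_iff by blast+
    show thesis
    proof (rule that[of "1 - r" A 1])
      show "1 - r < t" using ab by (simp add: r_def)
      show "enumerable A" unfolding A_def r_def using lsc ab(2) by (rule enumerable_superlevel)
    next
      fix n
      \<comment> \<open>Strings of \<open>A\<close> of length n carry at least k yes answers, so
        condition (2) for k leaves at most 2^(n-k) of them, and k is at least r n.\<close>
      define k where "k = nat \<lceil>r * real n\<rceil>"
      have r: "r > 0" using ab by (simp add: r_def)
      have "k \<le> yes_count l w" if w: "w \<in> A" "length w = n" for w
      proof (cases "n = 0")
        case False
        then have "r * real n < real (yes_count l w)"
          using w by (simp add: A_def AVG_eq pos_less_divide_eq)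
        then show ?thesis unfolding k_def by linarith
      qed (simp add: k_def)
      then have "card {w \<in> A. length w = n} \<le> card {w. length w = n \<and> k \<le> yes_count l w}"
        by (intro card_mono finite_subset[OF _ finite_length_eq[of "\<lambda>_. True" n]]) auto
      then have "real (card {w \<in> A. length w = n}) * 2 powr (r * real n) \<le>
          real (card {w. length w = n \<and> k \<le> yes_count l w}) * 2 ^ k"
      proof (intro mult_mono)
        have "r * real n \<le> real k" using r unfolding k_def by linarith
        then show "2 powr (r * real n) \<le> 2 ^ k" by (simp flip: powr_realpow)
      qed auto
      also have "\<dots> \<le> 2 powr real n" using meas by (simp add: powr_realpow)
      finally show "real (card {w \<in> A. length w = n}) \<le> 1 * 2 powr ((1 - r) * real n)"
        by (simp add: left_diff_distrib powr_diff pos_le_divide_eq)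
    next
      fix X assume "X \<in> \<Gamma>"
      then have "ereal (1 - s) \<le> limsup (\<lambda>n. ereal (AVG l (prefix X n)))"
        using l by (simp add: alg_learns_def)
      then have "ereal r < limsup (\<lambda>n. ereal (AVG l (prefix X n)))"
        by (rule order.strict_trans2[rotated]) (use ab(4) in \<open>simp add: r_def\<close>)
      then show "\<exists>\<^sub>F n in sequentially. prefix X n \<in> A"
        unfolding A_def mem_Collect_eq by (rule frequently_of_less_limsup)
    qed
  qed
qed

lemma succeeding_gale_of_sparse_set:
  assumes "enumerable A" "\<And>n. real (card {w \<in> A. length w = n}) \<le> C * 2 powr (s * real n)"
    and "\<And>X. X \<in> \<Gamma> \<Longrightarrow> \<exists>\<^sub>F n in sequentially. prefix X n \<in> A"
    and "a > 0" "b > 0" "2 powr t = real a / real b" "s < t"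
  obtains d where "lower_semicomputable d" "is_gale t d" "\<And>X. X \<in> \<Gamma> \<Longrightarrow> succeeds d X"
proof -
  obtain d where d: "lower_semicomputable d" "is_gale t d" "\<And>w. w \<in> A \<Longrightarrow> real (length w) \<le> d w"
    using gale_of_sparse_set[OF assms(1,2,4-7)] by blast
  have "succeeds d X" if X: "X \<in> \<Gamma>" for X
    unfolding succeeds_iff
  proof
    fix c
    have "\<forall>\<^sub>F n in sequentially. c < real n" by real_asymp
    from frequently_eventually_conj[OF assms(3)[OF X] this]
    show "\<exists>\<^sub>F n in sequentially. c < d (prefix X n)"
      by (rule frequently_elim1) (use d(3) length_prefix in \<open>metis order.strict_trans2\<close>)
  qed
  with d(1,2) show thesis by (rule that)
qed

text \<open>Elements of A are matched only up to an arbitrarily small loss. Both translations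
  between gales and learners increase the exponent, so this is the comparison they support.\<close>

lemma Inf_le_Inf:
  fixes A B :: "real set"
  assumes "A \<noteq> {}" "bdd_below B" "\<And>s t. s \<in> A \<Longrightarrow> s < t \<Longrightarrow> \<exists>u\<in>B. u < t"
  shows "Inf B \<le> Inf A"
proof (rule cInf_greatest[OF assms(1)], rule dense_ge)
  fix s t assume "s \<in> A" "s < t"
  then obtain u where "u \<in> B" "u < t" using assms(3) by blast
  then show "Inf B \<le> t" using cInf_lower[OF _ assms(2)] by fastforce
qed

theorem mainTheorem7:
  fixes \<Gamma> :: "(nat \<Rightarrow> bool) set"
  shows "alg_dim \<Gamma> = Inf (G_constr \<Gamma>)"
proof -
  define D where "D = {s. s \<ge> 0 \<and> (\<exists>d. lower_semicomputable d \<and> is_gale s d \<and> (\<forall>X\<in>\<Gamma>. succeeds d X))}"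
  have learner: "\<exists>u\<in>G_constr \<Gamma>. u < t" if s: "s \<in> D" "s < t" for s t
  proof -
    obtain d where d: "s \<ge> 0" "lower_semicomputable d" "is_gale s d" "\<And>X. X \<in> \<Gamma> \<Longrightarrow> succeeds d X"
      using s(1) unfolding D_def by blast
    obtain u and a b :: nat where u: "s < u" "u < t" "a > 0" "b > 0" "2 powr u = real a / real b"
      using log_rational_between[OF s(2)] .
    have "enumerable {w. d w > 1}" using enumerable_superlevel[OF d(2), of 1 1] by simp
    moreover have "\<exists>\<^sub>F n in sequentially. prefix X n \<in> {w. d w > 1}" if "X \<in> \<Gamma>" for X
      using d(4)[OF that] by (simp add: succeeds_iff)
    ultimately obtain e where e: "lower_semicomputable e" "is_gale u e" "\<And>X. X \<in> \<Gamma> \<Longrightarrow> succeeds e X"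
      using succeeding_gale_of_sparse_set[OF _ card_gale_exceeds[OF d(3)] _ u(3-5,1)] by blast
    obtain l where "\<And>X. succeeds e X \<Longrightarrow> alg_learns u l X"
      using learner_of_gale[OF e(1,2) u(3-5)] by blast
    then have "\<forall>X\<in>\<Gamma>. alg_learns u l X" using e(3) by blast
    moreover have "u \<ge> 0" using d(1) u(1) by simp
    ultimately have "u \<in> G_constr \<Gamma>" unfolding G_constr_def by blast
    then show ?thesis using u(2) by blast
  qed
  have gale: "\<exists>u\<in>D. u < t" if s: "s \<in> G_constr \<Gamma>" "s < t" for s t
  proof -
    obtain l where l: "s \<ge> 0" "\<And>X. X \<in> \<Gamma> \<Longrightarrow> alg_learns s l X"
      using s(1) unfolding G_constr_def by blast
    obtain A s' C where A: "s' < t" "enumerable A"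
      "\<And>n. real (card {w \<in> A. length w = n}) \<le> C * 2 powr (s' * real n)"
      "\<And>X. X \<in> \<Gamma> \<Longrightarrow> \<exists>\<^sub>F n in sequentially. prefix X n \<in> A"
      by (rule sparse_set_of_learner[OF l(2,1) s(2)]) (assumption | rule that)+
    \<comment> \<open>Exceeding s' makes the weighted series converge; exceeding s keeps the
      exponent nonnegative.\<close>
    obtain u and a b :: nat where u: "max s s' < u" "u < t" "a > 0" "b > 0" "2 powr u = real a / real b"
      using log_rational_between[of "max s s'" t] A(1) s(2) by auto
    have "s' < u" using u(1) by simp
    obtain d where "lower_semicomputable d" "is_gale u d" "\<And>X. X \<in> \<Gamma> \<Longrightarrow> succeeds d X"
      using succeeding_gale_of_sparse_set[OF A(2-4) u(3-5) \<open>s' < u\<close>] by blast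
    moreover have "u \<ge> 0" using l(1) u(1) by simp
    ultimately have "u \<in> D" unfolding D_def by blast
    then show ?thesis using u(2) by blast
  qed
  \<comment> \<open>The learner that never says yes 1-learns every sequence. It shows that both sets
    are nonempty, without which the real infimum would carry no information.\<close>
  define l0 :: "bool list \<Rightarrow> bool" where "l0 = (\<lambda>_. False)"
  have "alg_learns 1 l0 X" for X
  proof -
    have count: "yes_count l0 w = 0" for w by (simp add: yes_count_def l0_def)
    then have AVG: "AVG l0 = (\<lambda>_. 0)" by (simp add: fun_eq_iff AVG_eq)
    have "lower_semicomputable (\<lambda>_. 0)"
      by (rule lower_semicomputableI[where p = "\<lambda>_ _. 0" and q = "\<lambda>_ _. 0" and g = "\<lambda>_ _. 0"])
         (auto intro: computable_const)
    moreover have "real (card {w. length w = N \<and> n \<le> yes_count l0 w}) * 2 ^ n \<le> 2 ^ N" for n N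
      by (cases "n = 0") (simp_all add: card_length_eq count)
    ultimately show ?thesis
      unfolding alg_learns_def yes_event_measure_le_iff AVG by (simp add: Limsup_const)
  qed
  then have "1 \<in> G_constr \<Gamma>" by (auto simp: G_constr_def)
  then have "G_constr \<Gamma> \<noteq> {}" "D \<noteq> {}" using gale[of 1 2] by auto
  moreover have "bdd_below (G_constr \<Gamma>)" "bdd_below D"
    by (auto simp: G_constr_def D_def intro: bdd_belowI[of _ 0])
  ultimately have "Inf D = Inf (G_constr \<Gamma>)"
    using learner gale by (intro antisym Inf_le_Inf) auto
  then show ?thesis by (simp add: alg_dim_def D_def)
qed

end
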